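(* Let $\Bbbk$ be an integral domain, let $\mathcal G$ be a group, and let $\mathscr C$ be a generically $\mathcal G$-semi-simple pivotal $\Bbbk$-category. Assume that $\mathscr C$ is a Krull-Schmidt category and that for every non-zero $V\in\mathscr C$ the functors $V\otimes\cdot$ and $\cdot\otimes V$ are faithful. Let $\mathsf t=\{\mathsf t_V\}_{V\in\mathsf{Proj}}$ be a right trace on the ideal $\mathsf{Proj}$ of projective objects of $\mathscr C$, and let $\mathsf d(V)=\mathsf t_V(\mathrm{Id}_V)\in\Bbbk$, $V\in\mathsf{Proj}$, be the associated modified dimension. If $\mathsf d(V)=\mathsf d(V^* )$ holds for every generic simple object $V$ of $\mathscr C$, then $\mathsf t$ is a (two-sided) trace on $\mathsf{Proj}$.
   Context: Tensor categories are strict, with tensor product $\otimes$ and unit object $\mathbb I$. **$\Bbbk$-category.** Hom-sets are left $\Bbbk$-modules, composition is $\Bbbk$-bilinear, and $\Bbbk\to\operatorname{End}_{\mathscr C}(\mathbb I)$, $k\mapsto k\,\mathrm{Id}_{\mathbb I}$, is an isomorphism; for a tensor $\Bbbk$-category the tensor product of morphisms is also $\Bbbk$-bilinear. **Pivotal category.** Every object $V$ has a dual $V^*$ with morphisms $\mathrm{coev}_V:\mathbb I\to V\otimes V^*$, $\mathrm{ev}_V:V^*\otimes V\to\mathbb I$, $\widetilde{\mathrm{coev}}_V:\mathbb I\to V^*\otimes V$, $\widetilde{\mathrm{ev}}_V:V\otimes V^*\to\mathbb I$ satisfying the usual compatibility conditions: $(V^*,\mathrm{ev}_V,\mathrm{coev}_V)$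 is a left dual and $(V^*,\widetilde{\mathrm{ev}}_V,\widetilde{\mathrm{coev}}_V)$ a right dual of $V$, and the two resulting duality functors coincide as monoidal functors. The partial traces are: for $f\in\operatorname{End}(V\otimes W)$, $\operatorname{ptr}_R(f)=(\mathrm{Id}_V\otimes\widetilde{\mathrm{ev}}_W)(f\otimes\mathrm{Id}_{W^*})(\mathrm{Id}_V\otimes\mathrm{coev}_W)\in\operatorname{End}(V)$; for $f\in\operatorname{End}(W\otimes V)$, $\operatorname{ptr}_L(f)=(\mathrm{ev}_W\otimes\mathrm{Id}_V)(\mathrm{Id}_{W^*}\otimes f)(\widetilde{\mathrm{coev}}_W\otimes\mathrm{Id}_V)\in\operatorname{End}(V)$. **Retracts, sums, simple objects.** $V$ is simple if $\operatorname{End}_{\mathscr C}(V)=\Bbbk\,\mathrm{Id}_V$, and non-zero if $\mathrm{Id}_V\neq 0$. $V$ is a retract of $W$ if there are $\alpha:V\to W$, $\beta:W\to V$ with $\beta\alpha=\mathrm{Id}_V$. $W$ is a direct sum of a finite family $(V_i)$ if there are retracts $(V_i,\alpha_i,\beta_i)$ of $W$ with $\beta_i\alpha_j=0$ for $i\ne j$ and $\mathrm{Id}_W=\sum_i\alpha_i\beta_i$. An object is semi-simple if it is a direct sum of simple objects; a $\Bbbk$-category is semi-simple if all its objects are. An object is indecomposable if it is not isomorphic to a direct sum of two non-zero objects; Krull-Schmidt means every object is isomorphic to a unique direct sum of indecomposable objects. **Ideals and traces.** A right (resp. left) ideal is a full subcategory $\mathcal I$ closed under retracts and such that $V\in\mathcal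 I$, $W\in\mathscr C$ implies $V\otimes W\in\mathcal I$ (resp. $W\otimes V\in\mathcal I$); an ideal is both. A right trace on a right ideal $\mathcal I$ is a family of linear maps $\{\mathsf t_V:\operatorname{End}_{\mathscr C}(V)\to\Bbbk\}_{V\in\mathcal I}$ such that (1) $\mathsf t_V(gf)=\mathsf t_U(fg)$ for all $U,V\in\mathcal I$, $f:V\to U$, $g:U\to V$; (2) $\mathsf t_{U\otimes W}(f)=\mathsf t_U(\operatorname{ptr}_R(f))$ for all $U\in\mathcal I$, $W\in\mathscr C$, $f\in\operatorname{End}(U\otimes W)$. A left trace on a left ideal is defined with (2) replaced by $\mathsf t_{W\otimes U}(f)=\mathsf t_U(\operatorname{ptr}_L(f))$ for $f\in\operatorname{End}(W\otimes U)$. A trace on an ideal is a family which is both a left and a right trace. $\mathsf{Proj}$ is the class of projective objects ($P$ with $\operatorname{Hom}(P,-)$ preserving epimorphisms); it is an ideal, and it contains all generic simple objects. **$\mathcal G$-grading.** A pivotal $\Bbbk$-category $\mathscr C$ is $\mathcal G$-graded if for each $g\in\mathcal G$ there is a non-empty full subcategory $\mathscr C_g$, stable by retract, such that: (1) $\mathscr C=\bigoplus_{g\in\mathcal G}\mathscr C_g$ (every object is a finite direct sum of objects of the $\mathscr C_g$); (2) $V\in\mathscr C_g\Rightarrow V^*\in\mathscr C_{g^{-1}}$; (3) $V\in\mathscr C_g,V'\in\mathscr C_{g'}\Rightarrow V\otimes V'\in\mathscr C_{gg'}$; (4) if $V\in\mathscr C_g$, $V'\in\mathscr C_{g'}$ and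 $\operatorname{Hom}_{\mathscr C}(V,V')\ne0$ then $g=g'$. **Generic semi-simplicity.** A subset $\mathcal X\subset\mathcal G$ is symmetric if $\mathcal X^{-1}=\mathcal X$, and small if $\bigcup_{i=1}^n g_i\mathcal X\neq\mathcal G$ for all $g_1,\dots,g_n\in\mathcal G$. A $\mathcal G$-graded category is generically $\mathcal G$-semi-simple if there is a small symmetric subset $\mathcal X\subset\mathcal G$ (the singular locus) such that $\mathscr C_g$ is semi-simple for each $g\in\mathcal G\setminus\mathcal X$. A generic simple object is a simple object of $\mathscr C_g$ for some $g\in\mathcal G\setminus\mathcal X$. *)

theory Defs
  imports "HOL-Algebra.Module" "HOL-Algebra.Coset"
begin

section \<open>Strict tensor categories and pivotal categories\<close>

text \<open>
  Objects are the elements of \<^term>\<open>Ob C\<close>, and \<open>Hom C A B\<close> is the \<open>k\<close>-module of morphisms from \<open>A\<close>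
  to \<open>B\<close>; its ring fields \<^const>\<open>monoid.mult\<close> and \<^const>\<open>monoid.one\<close> are never used. \<open>g \<cdot> f\<close> is \<open>g\<close> after \<open>f\<close>.
  Operations are only constrained on objects and on morphisms that are composable. Hom-sets need not
  be disjoint as subsets of the type of morphisms: the source and target are always stated alongside.
\<close>

record ('k, 'o, 'm) category_data =
  Ob :: "'o set"
  Hom :: "'o \<Rightarrow> 'o \<Rightarrow> ('k, 'm) module"
  id_mor :: "'o \<Rightarrow> 'm" ("Idm\<index>")
  Comp :: "'m \<Rightarrow> 'm \<Rightarrow> 'm" (infixl "\<cdot>\<index>" 70)

record ('k, 'o, 'm) tensor_data = "('k, 'o, 'm) category_data" +
  tunit :: "'o" ("\<I>\<index>")
  tens_ob :: "'o \<Rightarrow> 'o \<Rightarrow> 'o" (infixl "\<otimes>\<^sub>o\<index>" 75)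
  tens_mor :: "'m \<Rightarrow> 'm \<Rightarrow> 'm" (infixl "\<otimes>\<^sub>m\<index>" 75)

record ('k, 'o, 'm) pivotal_data = "('k, 'o, 'm) tensor_data" +
  dual_ob :: "'o \<Rightarrow> 'o" ("dual\<index>")
  ev_mor :: "'o \<Rightarrow> 'm" ("ev\<index>")
  coev_mor :: "'o \<Rightarrow> 'm" ("coev\<index>")
  evt_mor :: "'o \<Rightarrow> 'm" ("evt\<index>")
  coevt_mor :: "'o \<Rightarrow> 'm" ("coevt\<index>")

abbreviation mor_set :: "('k, 'o, 'm, 'z) category_data_scheme \<Rightarrow> 'o \<Rightarrow> 'o \<Rightarrow> 'm set" ("mor\<index>")
  where "mor\<^bsub>C\<^esub> A B \<equiv> carrier (Hom C A B)"

locale category =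
  fixes C :: "('k, 'o, 'm, 'z) category_data_scheme" (structure)
  assumes Idm_closed: "A \<in> Ob C \<Longrightarrow> Idm A \<in> mor A A"
    and Comp_closed: "\<lbrakk>A \<in> Ob C; B \<in> Ob C; D \<in> Ob C; f \<in> mor A B; g \<in> mor B D\<rbrakk> \<Longrightarrow> g \<cdot> f \<in> mor A D"
    and Comp_Idm: "\<lbrakk>A \<in> Ob C; B \<in> Ob C; f \<in> mor A B\<rbrakk> \<Longrightarrow> f \<cdot> Idm A = f"
    and Idm_Comp: "\<lbrakk>A \<in> Ob C; B \<in> Ob C; f \<in> mor A B\<rbrakk> \<Longrightarrow> Idm B \<cdot> f = f"
    and Comp_assoc: "\<lbrakk>A \<in> Ob C; B \<in> Ob C; D \<in> Ob C; E \<in> Ob C; f \<in> mor A B; g \<in> mor B D; h \<in> mor D E\<rbrakk>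
      \<Longrightarrow> (h \<cdot> g) \<cdot> f = h \<cdot> (g \<cdot> f)"

locale strict_tensor_category = category C
  for C :: "('k, 'o, 'm, 'z) tensor_data_scheme" (structure) +
  assumes tunit_Ob: "\<I> \<in> Ob C"
    and tens_Ob: "\<lbrakk>A \<in> Ob C; B \<in> Ob C\<rbrakk> \<Longrightarrow> A \<otimes>\<^sub>o B \<in> Ob C"
    and tens_ob_assoc: "\<lbrakk>A \<in> Ob C; B \<in> Ob C; D \<in> Ob C\<rbrakk> \<Longrightarrow> (A \<otimes>\<^sub>o B) \<otimes>\<^sub>o D = A \<otimes>\<^sub>o (B \<otimes>\<^sub>o D)"
    and tunit_tens_ob: "A \<in> Ob C \<Longrightarrow> \<I> \<otimes>\<^sub>o A = A"
    and tens_ob_tunit: "A \<in> Ob C \<Longrightarrow> A \<otimes>\<^sub>o \<I> = A"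
    and tens_mor_closed: "\<lbrakk>A \<in> Ob C; B \<in> Ob C; A' \<in> Ob C; B' \<in> Ob C; f \<in> mor A B; f' \<in> mor A' B'\<rbrakk>
      \<Longrightarrow> f \<otimes>\<^sub>m f' \<in> mor (A \<otimes>\<^sub>o A') (B \<otimes>\<^sub>o B')"
    and tens_Idm: "\<lbrakk>A \<in> Ob C; B \<in> Ob C\<rbrakk> \<Longrightarrow> Idm A \<otimes>\<^sub>m Idm B = Idm (A \<otimes>\<^sub>o B)"
    and tens_Comp: "\<lbrakk>A \<in> Ob C; B \<in> Ob C; D \<in> Ob C; A' \<in> Ob C; B' \<in> Ob C; D' \<in> Ob C;
        f \<in> mor A B; g \<in> mor B D; f' \<in> mor A' B'; g' \<in> mor B' D'\<rbrakk>
      \<Longrightarrow> (g \<cdot> f) \<otimes>\<^sub>m (g' \<cdot> f') = (g \<otimes>\<^sub>m g') \<cdot> (f \<otimes>\<^sub>m f')"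
    and tens_mor_assoc: "\<lbrakk>A \<in> Ob C; B \<in> Ob C; A' \<in> Ob C; B' \<in> Ob C; A'' \<in> Ob C; B'' \<in> Ob C;
        f \<in> mor A B; f' \<in> mor A' B'; f'' \<in> mor A'' B''\<rbrakk>
      \<Longrightarrow> (f \<otimes>\<^sub>m f') \<otimes>\<^sub>m f'' = f \<otimes>\<^sub>m (f' \<otimes>\<^sub>m f'')"
    and tunit_tens_mor: "\<lbrakk>A \<in> Ob C; B \<in> Ob C; f \<in> mor A B\<rbrakk> \<Longrightarrow> Idm \<I> \<otimes>\<^sub>m f = f"
    and tens_mor_tunit: "\<lbrakk>A \<in> Ob C; B \<in> Ob C; f \<in> mor A B\<rbrakk> \<Longrightarrow> f \<otimes>\<^sub>m Idm \<I> = f"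

text \<open>Bijectivity suffices in \<open>scalars_bij\<close>: by bilinearity the map is a ring homomorphism.\<close>

locale tensor_k_category = strict_tensor_category C
  for R :: "('k, 'r) ring_scheme" and C :: "('k, 'o, 'm, 'z) tensor_data_scheme" (structure) +
  assumes Hom_module: "\<lbrakk>A \<in> Ob C; B \<in> Ob C\<rbrakk> \<Longrightarrow> module R (Hom C A B)"
    and Comp_add_right: "\<lbrakk>A \<in> Ob C; B \<in> Ob C; D \<in> Ob C; f \<in> mor A B; f' \<in> mor A B; g \<in> mor B D\<rbrakk>
      \<Longrightarrow> g \<cdot> (f \<oplus>\<^bsub>Hom C A B\<^esub> f') = g \<cdot> f \<oplus>\<^bsub>Hom C A D\<^esub> g \<cdot> f'"
    and Comp_add_left: "\<lbrakk>A \<in> Ob C; B \<in> Ob C; D \<in> Ob C; f \<in> mor A B; g \<in> mor B D; g' \<in> mor B D\<rbrakk>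
      \<Longrightarrow> (g \<oplus>\<^bsub>Hom C B D\<^esub> g') \<cdot> f = g \<cdot> f \<oplus>\<^bsub>Hom C A D\<^esub> g' \<cdot> f"
    and Comp_smult_right: "\<lbrakk>A \<in> Ob C; B \<in> Ob C; D \<in> Ob C; a \<in> carrier R; f \<in> mor A B; g \<in> mor B D\<rbrakk>
      \<Longrightarrow> g \<cdot> (a \<odot>\<^bsub>Hom C A B\<^esub> f) = a \<odot>\<^bsub>Hom C A D\<^esub> (g \<cdot> f)"
    and Comp_smult_left: "\<lbrakk>A \<in> Ob C; B \<in> Ob C; D \<in> Ob C; a \<in> carrier R; f \<in> mor A B; g \<in> mor B D\<rbrakk>
      \<Longrightarrow> (a \<odot>\<^bsub>Hom C B D\<^esub> g) \<cdot> f = a \<odot>\<^bsub>Hom C A D\<^esub> (g \<cdot> f)"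
    and tens_add_right: "\<lbrakk>A \<in> Ob C; B \<in> Ob C; A' \<in> Ob C; B' \<in> Ob C;
        f \<in> mor A B; f' \<in> mor A' B'; g' \<in> mor A' B'\<rbrakk>
      \<Longrightarrow> f \<otimes>\<^sub>m (f' \<oplus>\<^bsub>Hom C A' B'\<^esub> g') = f \<otimes>\<^sub>m f' \<oplus>\<^bsub>Hom C (A \<otimes>\<^sub>o A') (B \<otimes>\<^sub>o B')\<^esub> f \<otimes>\<^sub>m g'"
    and tens_add_left: "\<lbrakk>A \<in> Ob C; B \<in> Ob C; A' \<in> Ob C; B' \<in> Ob C;
        f \<in> mor A B; g \<in> mor A B; f' \<in> mor A' B'\<rbrakk>
      \<Longrightarrow> (f \<oplus>\<^bsub>Hom C A B\<^esub> g) \<otimes>\<^sub>m f' = f \<otimes>\<^sub>m f' \<oplus>\<^bsub>Hom C (A \<otimes>\<^sub>o A') (B \<otimes>\<^sub>o B')\<^esub> g \<otimes>\<^sub>m f'"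
    and tens_smult_right: "\<lbrakk>A \<in> Ob C; B \<in> Ob C; A' \<in> Ob C; B' \<in> Ob C; a \<in> carrier R;
        f \<in> mor A B; f' \<in> mor A' B'\<rbrakk>
      \<Longrightarrow> f \<otimes>\<^sub>m (a \<odot>\<^bsub>Hom C A' B'\<^esub> f') = a \<odot>\<^bsub>Hom C (A \<otimes>\<^sub>o A') (B \<otimes>\<^sub>o B')\<^esub> (f \<otimes>\<^sub>m f')"
    and tens_smult_left: "\<lbrakk>A \<in> Ob C; B \<in> Ob C; A' \<in> Ob C; B' \<in> Ob C; a \<in> carrier R;
        f \<in> mor A B; f' \<in> mor A' B'\<rbrakk>
      \<Longrightarrow> (a \<odot>\<^bsub>Hom C A B\<^esub> f) \<otimes>\<^sub>m f' = a \<odot>\<^bsub>Hom C (A \<otimes>\<^sub>o A') (B \<otimes>\<^sub>o B')\<^esub> (f \<otimes>\<^sub>m f')"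
    and scalars_bij: "bij_betw (\<lambda>a. a \<odot>\<^bsub>Hom C \<I> \<I>\<^esub> Idm \<I>) (carrier R) (mor \<I> \<I>)"

context
  fixes C :: "('k, 'o, 'm, 'z) pivotal_data_scheme" (structure)
begin

text \<open>For \<open>f : V \<rightarrow> W\<close>, the two transposes \<open>W\<^sup>* \<rightarrow> V\<^sup>*\<close>, i.e. the left and right duality functors on
  morphisms.\<close>

definition ldual_mor :: "'o \<Rightarrow> 'o \<Rightarrow> 'm \<Rightarrow> 'm" where
  "ldual_mor V W f =
    (ev W \<otimes>\<^sub>m Idm (dual V)) \<cdot> (Idm (dual W) \<otimes>\<^sub>m f \<otimes>\<^sub>m Idm (dual V)) \<cdot> (Idm (dual W) \<otimes>\<^sub>m coev V)"

definition rdual_mor :: "'o \<Rightarrow> 'o \<Rightarrow> 'm \<Rightarrow> 'm" where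
  "rdual_mor V W f =
    (Idm (dual V) \<otimes>\<^sub>m evt W) \<cdot> (Idm (dual V) \<otimes>\<^sub>m f \<otimes>\<^sub>m Idm (dual W)) \<cdot> (coevt V \<otimes>\<^sub>m Idm (dual W))"

text \<open>The monoidal constraints \<open>W\<^sup>* \<otimes> V\<^sup>* \<rightarrow> (V \<otimes> W)\<^sup>*\<close> of the left and right duality functors. Their unit
  constraints \<open>\<I> \<rightarrow> \<I>\<^sup>*\<close> are \<^term>\<open>coev \<I>\<close> and \<^term>\<open>coevt \<I>\<close>.\<close>

definition ldual_tens :: "'o \<Rightarrow> 'o \<Rightarrow> 'm" where
  "ldual_tens V W =
    (ev W \<otimes>\<^sub>m Idm (dual (V \<otimes>\<^sub>o W)))
    \<cdot> (Idm (dual W) \<otimes>\<^sub>m ev V \<otimes>\<^sub>m Idm W \<otimes>\<^sub>m Idm (dual (V \<otimes>\<^sub>o W)))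
    \<cdot> (Idm (dual W) \<otimes>\<^sub>m Idm (dual V) \<otimes>\<^sub>m coev (V \<otimes>\<^sub>o W))"

definition rdual_tens :: "'o \<Rightarrow> 'o \<Rightarrow> 'm" where
  "rdual_tens V W =
    (Idm (dual (V \<otimes>\<^sub>o W)) \<otimes>\<^sub>m evt V)
    \<cdot> (Idm (dual (V \<otimes>\<^sub>o W)) \<otimes>\<^sub>m Idm V \<otimes>\<^sub>m evt W \<otimes>\<^sub>m Idm (dual V))
    \<cdot> (coevt (V \<otimes>\<^sub>o W) \<otimes>\<^sub>m Idm (dual W) \<otimes>\<^sub>m Idm (dual V))"

text \<open>\<open>ptrR V W f\<close> is the right partial trace of \<open>f \<in> End(V \<otimes> W)\<close>, and \<open>ptrL W V f\<close> the left partial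
  trace of \<open>f \<in> End(W \<otimes> V)\<close>; both lie in \<open>End(V)\<close>.\<close>

definition ptrR :: "'o \<Rightarrow> 'o \<Rightarrow> 'm \<Rightarrow> 'm" where
  "ptrR V W f = (Idm V \<otimes>\<^sub>m evt W) \<cdot> (f \<otimes>\<^sub>m Idm (dual W)) \<cdot> (Idm V \<otimes>\<^sub>m coev W)"

definition ptrL :: "'o \<Rightarrow> 'o \<Rightarrow> 'm \<Rightarrow> 'm" where
  "ptrL W V f = (ev W \<otimes>\<^sub>m Idm V) \<cdot> (Idm (dual W) \<otimes>\<^sub>m f) \<cdot> (coevt W \<otimes>\<^sub>m Idm V)"

end

locale pivotal_category = strict_tensor_category C
  for C :: "('k, 'o, 'm, 'z) pivotal_data_scheme" (structure) +
  assumes dual_Ob: "V \<in> Ob C \<Longrightarrow> dual V \<in> Ob C"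
    and coev_closed: "V \<in> Ob C \<Longrightarrow> coev V \<in> mor \<I> (V \<otimes>\<^sub>o dual V)"
    and ev_closed: "V \<in> Ob C \<Longrightarrow> ev V \<in> mor (dual V \<otimes>\<^sub>o V) \<I>"
    and coevt_closed: "V \<in> Ob C \<Longrightarrow> coevt V \<in> mor \<I> (dual V \<otimes>\<^sub>o V)"
    and evt_closed: "V \<in> Ob C \<Longrightarrow> evt V \<in> mor (V \<otimes>\<^sub>o dual V) \<I>"
    and left_dual1: "V \<in> Ob C \<Longrightarrow> (Idm V \<otimes>\<^sub>m ev V) \<cdot> (coev V \<otimes>\<^sub>m Idm V) = Idm V"
    and left_dual2: "V \<in> Ob C \<Longrightarrow> (ev V \<otimes>\<^sub>m Idm (dual V)) \<cdot> (Idm (dual V) \<otimes>\<^sub>m coev V) = Idm (dual V)"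
    and right_dual1: "V \<in> Ob C \<Longrightarrow> (evt V \<otimes>\<^sub>m Idm V) \<cdot> (Idm V \<otimes>\<^sub>m coevt V) = Idm V"
    and right_dual2: "V \<in> Ob C \<Longrightarrow> (Idm (dual V) \<otimes>\<^sub>m evt V) \<cdot> (coevt V \<otimes>\<^sub>m Idm (dual V)) = Idm (dual V)"
    and dual_functors_mor:
      "\<lbrakk>V \<in> Ob C; W \<in> Ob C; f \<in> mor V W\<rbrakk> \<Longrightarrow> ldual_mor C V W f = rdual_mor C V W f"
    and dual_functors_tens: "\<lbrakk>V \<in> Ob C; W \<in> Ob C\<rbrakk> \<Longrightarrow> ldual_tens C V W = rdual_tens C V W"
    and dual_functors_unit: "coev \<I> = coevt \<I>"

locale pivotal_k_category = tensor_k_category R C + pivotal_category C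
  for R :: "('k, 'r) ring_scheme" and C :: "('k, 'o, 'm, 'z) pivotal_data_scheme" (structure)

section \<open>Retracts, direct sums, simple objects\<close>

context
  fixes C :: "('k, 'o, 'm, 'z) category_data_scheme" (structure)
begin

definition nonzero :: "'o \<Rightarrow> bool" where
  "nonzero V \<longleftrightarrow> V \<in> Ob C \<and> Idm V \<noteq> \<zero>\<^bsub>Hom C V V\<^esub>"

definition simple_obj :: "('k, 'r) ring_scheme \<Rightarrow> 'o \<Rightarrow> bool" where
  "simple_obj R V \<longleftrightarrow> V \<in> Ob C \<and> mor V V = {a \<odot>\<^bsub>Hom C V V\<^esub> Idm V | a. a \<in> carrier R}"

definition retract_via :: "'o \<Rightarrow> 'o \<Rightarrow> 'm \<Rightarrow> 'm \<Rightarrow> bool" where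
  "retract_via V W \<alpha> \<beta> \<longleftrightarrow> \<alpha> \<in> mor V W \<and> \<beta> \<in> mor W V \<and> \<beta> \<cdot> \<alpha> = Idm V"

definition retract_of :: "'o \<Rightarrow> 'o \<Rightarrow> bool" where
  "retract_of V W \<longleftrightarrow> V \<in> Ob C \<and> W \<in> Ob C \<and> (\<exists>\<alpha> \<beta>. retract_via V W \<alpha> \<beta>)"

definition isomorphic :: "'o \<Rightarrow> 'o \<Rightarrow> bool" where
  "isomorphic V W \<longleftrightarrow> V \<in> Ob C \<and> W \<in> Ob C \<and>
    (\<exists>f\<in>mor V W. \<exists>g\<in>mor W V. g \<cdot> f = Idm V \<and> f \<cdot> g = Idm W)"

text \<open>Finite families are lists; the empty family is allowed, its direct sums are the zero objects.\<close>

definition direct_sum :: "'o \<Rightarrow> 'o list \<Rightarrow> bool" where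
  "direct_sum W Vs \<longleftrightarrow> W \<in> Ob C \<and> set Vs \<subseteq> Ob C \<and>
    (\<exists>\<alpha> \<beta>. (\<forall>i<length Vs. retract_via (Vs ! i) W (\<alpha> i) (\<beta> i)) \<and>
       (\<forall>i<length Vs. \<forall>j<length Vs. i \<noteq> j \<longrightarrow> \<beta> i \<cdot> \<alpha> j = \<zero>\<^bsub>Hom C (Vs ! j) (Vs ! i)\<^esub>) \<and>
       Idm W = (\<Oplus>\<^bsub>Hom C W W\<^esub>i\<in>{..<length Vs}. \<alpha> i \<cdot> \<beta> i))"

definition semisimple_obj :: "('k, 'r) ring_scheme \<Rightarrow> 'o \<Rightarrow> bool" where
  "semisimple_obj R W \<longleftrightarrow> (\<exists>Vs. direct_sum W Vs \<and> (\<forall>V\<in>set Vs. simple_obj R V))"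

text \<open>Zero objects are not indecomposable; otherwise no decomposition would be unique as soon as a zero
  object exists.\<close>

definition indecomposable :: "'o \<Rightarrow> bool" where
  "indecomposable V \<longleftrightarrow> nonzero V \<and>
    \<not> (\<exists>W A B. isomorphic V W \<and> direct_sum W [A, B] \<and> nonzero A \<and> nonzero B)"

definition indecomposable_decomp :: "'o \<Rightarrow> 'o list \<Rightarrow> bool" where
  "indecomposable_decomp V Vs \<longleftrightarrow>
    (\<exists>W. isomorphic V W \<and> direct_sum W Vs) \<and> (\<forall>U\<in>set Vs. indecomposable U)"

text \<open>Uniqueness is up to isomorphism and order of the summands.\<close>

definition krull_schmidt :: bool where
  "krull_schmidt \<longleftrightarrow>
    (\<forall>V\<in>Ob C. (\<exists>Vs. indecomposable_decomp V Vs) \<and>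
      (\<forall>Us Vs. indecomposable_decomp V Us \<and> indecomposable_decomp V Vs \<longrightarrow>
        (\<exists>\<pi>. bij_betw \<pi> {..<length Us} {..<length Vs} \<and>
          (\<forall>i<length Us. isomorphic (Us ! i) (Vs ! \<pi> i)))))"

definition epi :: "'o \<Rightarrow> 'o \<Rightarrow> 'm \<Rightarrow> bool" where
  "epi A B e \<longleftrightarrow> e \<in> mor A B \<and>
    (\<forall>Z\<in>Ob C. \<forall>f\<in>mor B Z. \<forall>g\<in>mor B Z. f \<cdot> e = g \<cdot> e \<longrightarrow> f = g)"

definition Proj :: "'o set" where
  "Proj = {P \<in> Ob C. \<forall>A\<in>Ob C. \<forall>B\<in>Ob C. \<forall>e. epi A B e \<longrightarrow> (\<lambda>f. e \<cdot> f) ` mor P A = mor P B}"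

end

section \<open>Ideals and traces\<close>

context
  fixes C :: "('k, 'o, 'm, 'z) tensor_data_scheme" (structure)
begin

definition faithful_tensor :: "'o \<Rightarrow> bool" where
  "faithful_tensor V \<longleftrightarrow> (\<forall>A\<in>Ob C. \<forall>B\<in>Ob C.
    inj_on (\<lambda>f. Idm V \<otimes>\<^sub>m f) (mor A B) \<and> inj_on (\<lambda>f. f \<otimes>\<^sub>m Idm V) (mor A B))"

definition right_ideal :: "'o set \<Rightarrow> bool" where
  "right_ideal I \<longleftrightarrow> I \<subseteq> Ob C \<and> (\<forall>V W. W \<in> I \<and> retract_of C V W \<longrightarrow> V \<in> I) \<and>
    (\<forall>V\<in>I. \<forall>W\<in>Ob C. V \<otimes>\<^sub>o W \<in> I)"

definition left_ideal :: "'o set \<Rightarrow> bool" where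
  "left_ideal I \<longleftrightarrow> I \<subseteq> Ob C \<and> (\<forall>V W. W \<in> I \<and> retract_of C V W \<longrightarrow> V \<in> I) \<and>
    (\<forall>V\<in>I. \<forall>W\<in>Ob C. W \<otimes>\<^sub>o V \<in> I)"

end

definition linear_form :: "('k, 'r) ring_scheme \<Rightarrow> ('k, 'm, 's) module_scheme \<Rightarrow> ('m \<Rightarrow> 'k) \<Rightarrow> bool" where
  "linear_form R M \<phi> \<longleftrightarrow> \<phi> \<in> carrier M \<rightarrow> carrier R \<and>
    (\<forall>x\<in>carrier M. \<forall>y\<in>carrier M. \<phi> (x \<oplus>\<^bsub>M\<^esub> y) = \<phi> x \<oplus>\<^bsub>R\<^esub> \<phi> y) \<and>
    (\<forall>a\<in>carrier R. \<forall>x\<in>carrier M. \<phi> (a \<odot>\<^bsub>M\<^esub> x) = a \<otimes>\<^bsub>R\<^esub> \<phi> x)"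

text \<open>A family \<open>(t\<^sub>V)\<close> indexed by an ideal is a function on all of \<^typ>\<open>'o\<close> whose values outside the ideal
  (and outside \<open>End(V)\<close>) are irrelevant.\<close>

context
  fixes R :: "('k, 'r) ring_scheme" and C :: "('k, 'o, 'm, 'z) pivotal_data_scheme" (structure)
begin

definition cyclic_linear_family :: "'o set \<Rightarrow> ('o \<Rightarrow> 'm \<Rightarrow> 'k) \<Rightarrow> bool" where
  "cyclic_linear_family I t \<longleftrightarrow>
    (\<forall>V\<in>I. linear_form R (Hom C V V) (t V)) \<and>
    (\<forall>U\<in>I. \<forall>V\<in>I. \<forall>f\<in>mor V U. \<forall>g\<in>mor U V. t V (g \<cdot> f) = t U (f \<cdot> g))"

definition right_trace :: "'o set \<Rightarrow> ('o \<Rightarrow> 'm \<Rightarrow> 'k) \<Rightarrow> bool" where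
  "right_trace I t \<longleftrightarrow> right_ideal C I \<and> cyclic_linear_family I t \<and>
    (\<forall>U\<in>I. \<forall>W\<in>Ob C. \<forall>f\<in>mor (U \<otimes>\<^sub>o W) (U \<otimes>\<^sub>o W). t (U \<otimes>\<^sub>o W) f = t U (ptrR C U W f))"

definition left_trace :: "'o set \<Rightarrow> ('o \<Rightarrow> 'm \<Rightarrow> 'k) \<Rightarrow> bool" where
  "left_trace I t \<longleftrightarrow> left_ideal C I \<and> cyclic_linear_family I t \<and>
    (\<forall>U\<in>I. \<forall>W\<in>Ob C. \<forall>f\<in>mor (W \<otimes>\<^sub>o U) (W \<otimes>\<^sub>o U). t (W \<otimes>\<^sub>o U) f = t U (ptrL C W U f))"

definition two_sided_trace :: "'o set \<Rightarrow> ('o \<Rightarrow> 'm \<Rightarrow> 'k) \<Rightarrow> bool" where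
  "two_sided_trace I t \<longleftrightarrow> left_trace I t \<and> right_trace I t"

definition mdim :: "('o \<Rightarrow> 'm \<Rightarrow> 'k) \<Rightarrow> 'o \<Rightarrow> 'k" where
  "mdim t V = t V (Idm V)"

end

section \<open>Gradings and generic semi-simplicity\<close>

text \<open>\<open>Cg g\<close> is the set of objects of the full subcategory of degree \<open>g\<close>. That it be non-empty is
  read as containing a non-zero object: a zero object may belong to every degree and so carries no
  information.\<close>

definition graded ::
  "('g, 'h) monoid_scheme \<Rightarrow> ('k, 'o, 'm, 'z) pivotal_data_scheme \<Rightarrow> ('g \<Rightarrow> 'o set) \<Rightarrow> bool" where
  "graded G C Cg \<longleftrightarrow>
    (\<forall>g\<in>carrier G. Cg g \<subseteq> Ob C \<and> (\<exists>V\<in>Cg g. nonzero C V) \<and>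
       (\<forall>V W. W \<in> Cg g \<and> retract_of C V W \<longrightarrow> V \<in> Cg g)) \<and>
    (\<forall>W\<in>Ob C. \<exists>Vs. direct_sum C W Vs \<and> (\<forall>V\<in>set Vs. \<exists>g\<in>carrier G. V \<in> Cg g)) \<and>
    (\<forall>g\<in>carrier G. \<forall>V\<in>Cg g. dual\<^bsub>C\<^esub> V \<in> Cg (inv\<^bsub>G\<^esub> g)) \<and>
    (\<forall>g\<in>carrier G. \<forall>g'\<in>carrier G. \<forall>V\<in>Cg g. \<forall>V'\<in>Cg g'. V \<otimes>\<^sub>o\<^bsub>C\<^esub> V' \<in> Cg (g \<otimes>\<^bsub>G\<^esub> g')) \<and>
    (\<forall>g\<in>carrier G. \<forall>g'\<in>carrier G. \<forall>V\<in>Cg g. \<forall>V'\<in>Cg g'.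
       mor\<^bsub>C\<^esub> V V' \<noteq> {\<zero>\<^bsub>Hom C V V'\<^esub>} \<longrightarrow> g = g')"

definition symmetric_subset :: "('g, 'h) monoid_scheme \<Rightarrow> 'g set \<Rightarrow> bool" where
  "symmetric_subset G X \<longleftrightarrow> X \<subseteq> carrier G \<and> set_inv\<^bsub>G\<^esub> X = X"

definition small_subset :: "('g, 'h) monoid_scheme \<Rightarrow> 'g set \<Rightarrow> bool" where
  "small_subset G X \<longleftrightarrow> X \<subseteq> carrier G \<and>
    (\<forall>F. finite F \<and> F \<subseteq> carrier G \<longrightarrow> (\<Union>g\<in>F. g <#\<^bsub>G\<^esub> X) \<noteq> carrier G)"

definition generically_semisimple ::
  "('k, 'r) ring_scheme \<Rightarrow> ('g, 'h) monoid_scheme \<Rightarrow> ('k, 'o, 'm, 'z) pivotal_data_scheme \<Rightarrow>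
    ('g \<Rightarrow> 'o set) \<Rightarrow> 'g set \<Rightarrow> bool" where
  "generically_semisimple R G C Cg X \<longleftrightarrow>
    graded G C Cg \<and> symmetric_subset G X \<and> small_subset G X \<and>
    (\<forall>g\<in>carrier G - X. \<forall>V\<in>Cg g. semisimple_obj C R V)"

definition generic_simple ::
  "('k, 'r) ring_scheme \<Rightarrow> ('g, 'h) monoid_scheme \<Rightarrow> ('k, 'o, 'm, 'z) pivotal_data_scheme \<Rightarrow>
    ('g \<Rightarrow> 'o set) \<Rightarrow> 'g set \<Rightarrow> 'o \<Rightarrow> bool" where
  "generic_simple R G C Cg X V \<longleftrightarrow> simple_obj C R V \<and> (\<exists>g\<in>carrier G - X. V \<in> Cg g)"

end

theory Submission
  imports Defs
begin

text \<open>
  A right trace \<open>t\<close> has a dual \<open>t'\<close>, given by \<open>t'\<^sub>V(f) = t(f\<^sup>*)\<close> on \<open>V\<^sup>*\<close>. It is again cyclic and linear, and,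
  because duality reverses tensor products, it has the left trace property (\<open>dual_trace_ptraceL\<close>).
  Hence it suffices to show that \<open>t = t'\<close> on all projective objects.

  On a generic simple \<open>V\<close> every endomorphism is a scalar, so \<open>t\<^sub>V\<close> and \<open>t'\<^sub>V\<close> are determined by their
  values \<open>d(V)\<close> and \<open>d(V\<^sup>*)\<close> at the identity, which are equal by hypothesis. Cyclicity and linearity
  extend the agreement to direct sums of such objects, that is, to every projective object
  whose degree lies outside the singular locus.

  An arbitrary homogeneous projective \<open>P\<close> is reached by surrounding it with non-zero objects \<open>Q\<close> and
  \<open>Q'\<close>. Faithfulness of tensoring makes \<open>P\<close> a retract of \<open>Q\<^sup>* \<otimes> Q \<otimes> P \<otimes> Q' \<otimes> Q'\<^sup>*\<close>
  (\<open>Proj_retract_left\<close>, \<open>Proj_retract_right\<close>). With \<open>S = Q \<otimes> P \<otimes> Q'\<close>, smallness of the singular locus allows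
  the degrees of \<open>Q\<close> and \<open>Q'\<close> to be chosen such that \<open>S\<close>, \<open>Q\<^sup>* \<otimes> S\<close> and \<open>S \<otimes> Q'\<^sup>*\<close> are all generic, although
  the whole product has the degree of \<open>P\<close>. There \<open>t\<close> can be computed by closing the right
  strand and \<open>t'\<close> by closing the left one; both pass through generic objects and meet on \<open>S\<close>
  (\<open>agree_at_sandwich\<close>). Since every projective object is a direct sum of homogeneous ones,
  the traces agree everywhere.
\<close>

section \<open>Arrows with explicit ends\<close>

text \<open>Since hom-sets may overlap, a morphism does not determine its source and target, and the side
  conditions of the category axioms leave the intermediate objects to be guessed. An arrow carries
  its two ends, so that composability becomes an equation between objects which the simplifier decides.\<close>

datatype ('o, 'm) arrow = Arrow (src: 'o) (label: 'm) (trg: 'o)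

context strict_tensor_category
begin

definition cmp :: "('o, 'm) arrow \<Rightarrow> ('o, 'm) arrow \<Rightarrow> ('o, 'm) arrow" (infixr "\<bullet>" 60)
  where "y \<bullet> x = Arrow (src x) (label y \<cdot> label x) (trg y)"

definition tens :: "('o, 'm) arrow \<Rightarrow> ('o, 'm) arrow \<Rightarrow> ('o, 'm) arrow" (infixr "\<star>" 70)
  where "x \<star> y = Arrow (src x \<otimes>\<^sub>o src y) (label x \<otimes>\<^sub>m label y) (trg x \<otimes>\<^sub>o trg y)"

definition idt :: "'o \<Rightarrow> ('o, 'm) arrow"
  where "idt A = Arrow A (Idm A) A"

text \<open>Composition and tensor product are total operations on arrows; \<open>arr\<close> singles out the arrows that
  are genuine morphisms.\<close>

definition arr :: "('o, 'm) arrow \<Rightarrow> bool"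
  where "arr x \<longleftrightarrow> src x \<in> Ob C \<and> trg x \<in> Ob C \<and> label x \<in> mor (src x) (trg x)"

lemma src_trg [simp]:
  "src (y \<bullet> x) = src x" "trg (y \<bullet> x) = trg y"
  "src (x \<star> y) = src x \<otimes>\<^sub>o src y" "trg (x \<star> y) = trg x \<otimes>\<^sub>o trg y"
  "src (idt A) = A" "trg (idt A) = A"
  by (simp_all add: cmp_def tens_def idt_def)

lemma arr_Arrow [simp]: "arr (Arrow A f B) \<longleftrightarrow> A \<in> Ob C \<and> B \<in> Ob C \<and> f \<in> mor A B"
  by (simp add: arr_def)

lemma arr_objects: "arr x \<Longrightarrow> src x \<in> Ob C" "arr x \<Longrightarrow> trg x \<in> Ob C"
  by (simp_all add: arr_def)

lemma arr_label: "arr x \<Longrightarrow> label x \<in> mor (src x) (trg x)"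
  by (simp add: arr_def)

lemma arr_idt [simp]: "A \<in> Ob C \<Longrightarrow> arr (idt A)"
  by (simp add: idt_def Idm_closed)

lemma arr_cmp [simp]: "\<lbrakk>arr x; arr y; src y = trg x\<rbrakk> \<Longrightarrow> arr (y \<bullet> x)"
  using Comp_closed[of "src x" "trg x" "trg y" "label x" "label y"] by (simp add: arr_def cmp_def)

lemma arr_tens [simp]: "\<lbrakk>arr x; arr y\<rbrakk> \<Longrightarrow> arr (x \<star> y)"
  using tens_mor_closed[of "src x" "trg x" "src y" "trg y"] by (simp add: arr_def tens_def tens_Ob)

text \<open>Tensor words of objects and of arrows are bracketed to the right, and composites likewise
  (\<open>cmp_assoc\<close>). Identities of tensor products are split or merged as a computation requires, so
  \<open>idt_tens_idt\<close> is not a default rule.\<close>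

lemmas ob_simps [simp] = tunit_Ob tens_Ob tens_ob_assoc tunit_tens_ob tens_ob_tunit

lemma cmp_assoc:
  "\<lbrakk>arr x; arr y; arr z; src y = trg x; src z = trg y\<rbrakk> \<Longrightarrow> (z \<bullet> y) \<bullet> x = z \<bullet> y \<bullet> x"
  using Comp_assoc[of "src x" "trg x" "trg y" "trg z" "label x" "label y" "label z"]
  by (simp add: arr_def cmp_def)

lemma cmp_idt [simp]: "\<lbrakk>arr x; src x = A\<rbrakk> \<Longrightarrow> x \<bullet> idt A = x"
  using Comp_Idm[of "src x" "trg x"] by (cases x) (auto simp: arr_def cmp_def idt_def)

lemma idt_cmp [simp]: "\<lbrakk>arr x; trg x = A\<rbrakk> \<Longrightarrow> idt A \<bullet> x = x"
  using Idm_Comp[of "src x" "trg x"] by (cases x) (auto simp: arr_def cmp_def idt_def)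

lemma tens_assoc [simp]: "\<lbrakk>arr x; arr y; arr z\<rbrakk> \<Longrightarrow> (x \<star> y) \<star> z = x \<star> y \<star> z"
  using tens_mor_assoc[of "src x" "trg x" "src y" "trg y" "src z" "trg z"] by (simp add: arr_def tens_def)

lemma idt_tunit_tens [simp]: "arr x \<Longrightarrow> idt \<I> \<star> x = x"
  using tunit_tens_mor[of "src x" "trg x"] by (cases x) (simp add: arr_def tens_def idt_def)

lemma tens_idt_tunit [simp]: "arr x \<Longrightarrow> x \<star> idt \<I> = x"
  using tens_mor_tunit[of "src x" "trg x"] by (cases x) (simp add: arr_def tens_def idt_def)

lemma idt_tens_idt: "\<lbrakk>A \<in> Ob C; B \<in> Ob C\<rbrakk> \<Longrightarrow> idt A \<star> idt B = idt (A \<otimes>\<^sub>o B)"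
  by (simp add: tens_def idt_def tens_Idm)

lemma interchange:
  "\<lbrakk>arr x; arr y; arr x'; arr y'; src y = trg x; src y' = trg x'\<rbrakk>
    \<Longrightarrow> (y \<bullet> x) \<star> (y' \<bullet> x') = (y \<star> y') \<bullet> (x \<star> x')"
  using tens_Comp[of "src x" "trg x" "trg y" "src x'" "trg x'" "trg y'"] by (simp add: arr_def tens_def cmp_def)

(* As a rewrite rule, arr_objects would loop with unfolding arr_def in the proofs above. *)
declare arr_objects [simp]

lemma idt_tens_cmp:
  "\<lbrakk>arr x; arr y; src y = trg x; A \<in> Ob C\<rbrakk> \<Longrightarrow> idt A \<star> (y \<bullet> x) = (idt A \<star> y) \<bullet> (idt A \<star> x)"
  using interchange[of "idt A" "idt A" x y] by simp

lemma cmp_tens_idt: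
  "\<lbrakk>arr x; arr y; src y = trg x; A \<in> Ob C\<rbrakk> \<Longrightarrow> (y \<bullet> x) \<star> idt A = (y \<star> idt A) \<bullet> (x \<star> idt A)"
  using interchange[of x y "idt A" "idt A"] by simp

text \<open>Two arrows on disjoint strands can be applied in either order. Taking \<open>A\<close>, \<open>B\<close> or \<open>D\<close> to be the
  unit in \<open>slide_left\<close> and \<open>slide_right\<close> gives the form in which an evaluation or coevaluation moves
  past another arrow.\<close>

lemma slide_left:
  "\<lbrakk>arr x; arr y; src x = A; trg y = D\<rbrakk> \<Longrightarrow> (x \<star> idt D) \<bullet> (idt A \<star> y) = x \<star> y"
  using interchange[of "idt A" x y "idt D"] by auto

lemma slide_right:
  "\<lbrakk>arr x; arr y; trg x = B; src y = D\<rbrakk> \<Longrightarrow> (idt B \<star> y) \<bullet> (x \<star> idt D) = x \<star> y"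
  using interchange[of x "idt B" "idt D" y] by auto

lemma cmp_tens_idt_idt:
  "\<lbrakk>arr x; arr y; src y = trg x; A \<in> Ob C; B \<in> Ob C\<rbrakk>
    \<Longrightarrow> (y \<bullet> x) \<star> idt A \<star> idt B = (y \<star> idt A \<star> idt B) \<bullet> (x \<star> idt A \<star> idt B)"
  using cmp_tens_idt[of x y "A \<otimes>\<^sub>o B"] by (simp flip: idt_tens_idt)

lemmas whisker = idt_tens_cmp cmp_tens_idt cmp_tens_idt_idt

end

section \<open>Duality and partial traces\<close>

context pivotal_category
begin

definition Ev where "Ev V = Arrow (dual V \<otimes>\<^sub>o V) (ev V) \<I>"
definition Coev where "Coev V = Arrow \<I> (coev V) (V \<otimes>\<^sub>o dual V)"
definition Evt where "Evt V = Arrow (V \<otimes>\<^sub>o dual V) (evt V) \<I>"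
definition Coevt where "Coevt V = Arrow \<I> (coevt V) (dual V \<otimes>\<^sub>o V)"

declare dual_Ob [simp]

lemma arr_duality [simp]:
  "V \<in> Ob C \<Longrightarrow> arr (Ev V)" "V \<in> Ob C \<Longrightarrow> arr (Coev V)"
  "V \<in> Ob C \<Longrightarrow> arr (Evt V)" "V \<in> Ob C \<Longrightarrow> arr (Coevt V)"
  by (simp_all add: Ev_def Coev_def Evt_def Coevt_def ev_closed coev_closed evt_closed coevt_closed)

lemma src_trg_duality [simp]:
  "src (Ev V) = dual V \<otimes>\<^sub>o V" "trg (Ev V) = \<I>" "src (Coev V) = \<I>" "trg (Coev V) = V \<otimes>\<^sub>o dual V"
  "src (Evt V) = V \<otimes>\<^sub>o dual V" "trg (Evt V) = \<I>" "src (Coevt V) = \<I>" "trg (Coevt V) = dual V \<otimes>\<^sub>o V"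
  by (simp_all add: Ev_def Coev_def Evt_def Coevt_def)

lemmas arrow_defs = cmp_def tens_def idt_def Ev_def Coev_def Evt_def Coevt_def

lemma zigzag:
  assumes "V \<in> Ob C"
  shows "(idt V \<star> Ev V) \<bullet> (Coev V \<star> idt V) = idt V"
    and "(Ev V \<star> idt (dual V)) \<bullet> (idt (dual V) \<star> Coev V) = idt (dual V)"
    and "(Evt V \<star> idt V) \<bullet> (idt V \<star> Coevt V) = idt V"
    and "(idt (dual V) \<star> Evt V) \<bullet> (Coevt V \<star> idt (dual V)) = idt (dual V)"
  using assms left_dual1 left_dual2 right_dual1 right_dual2 by (simp_all add: arrow_defs)

text \<open>Bending the \<open>T\<close>-leg of \<open>e : A \<otimes> T \<rightarrow> \<I>\<close> up with \<open>coev\<^sub>T\<close> and back down with \<open>ev\<^sub>T\<close> returns \<open>e\<close>,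
  by a zigzag identity. The transposes of morphisms and the monoidal constraints of the duality functors
  are such mates, so this and its mirror image \<open>mate_Coevt\<close> describe how they interact with \<open>ev\<close> and
  \<open>coev\<close>.\<close>

lemma mate_Ev:
  assumes "A \<in> Ob C" "T \<in> Ob C" "arr e" "src e = A \<otimes>\<^sub>o T" "trg e = \<I>"
  shows "Ev T \<bullet> (((e \<star> idt (dual T)) \<bullet> (idt A \<star> Coev T)) \<star> idt T) = e"
proof -
  have "Ev T \<bullet> (((e \<star> idt (dual T)) \<bullet> (idt A \<star> Coev T)) \<star> idt T)
      = (Ev T \<bullet> (e \<star> idt (dual T \<otimes>\<^sub>o T))) \<bullet> (idt A \<star> Coev T \<star> idt T)"
    using assms by (simp add: cmp_tens_idt cmp_assoc flip: idt_tens_idt)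
  also have "Ev T \<bullet> (e \<star> idt (dual T \<otimes>\<^sub>o T)) = e \<bullet> (idt (A \<otimes>\<^sub>o T) \<star> Ev T)"
    using assms slide_right[of e "Ev T" \<I> "dual T \<otimes>\<^sub>o T"] slide_left[of e "Ev T" "A \<otimes>\<^sub>o T" \<I>] by simp
  also have "\<dots> \<bullet> (idt A \<star> Coev T \<star> idt T) = e \<bullet> (idt A \<star> ((idt T \<star> Ev T) \<bullet> (Coev T \<star> idt T)))"
    using assms by (simp add: idt_tens_cmp cmp_assoc flip: idt_tens_idt)
  also have "\<dots> = e"
    using assms by (simp add: zigzag idt_tens_idt)
  finally show ?thesis .
qed

lemma mate_Coevt:
  assumes "A \<in> Ob C" "T \<in> Ob C" "arr c" "src c = \<I>" "trg c = A \<otimes>\<^sub>o T"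
  shows "(((idt A \<star> Evt T) \<bullet> (c \<star> idt (dual T))) \<star> idt T) \<bullet> Coevt T = c"
proof -
  have "(((idt A \<star> Evt T) \<bullet> (c \<star> idt (dual T))) \<star> idt T) \<bullet> Coevt T
      = (idt A \<star> Evt T \<star> idt T) \<bullet> ((c \<star> idt (dual T \<otimes>\<^sub>o T)) \<bullet> Coevt T)"
    using assms by (simp add: cmp_tens_idt cmp_assoc flip: idt_tens_idt)
  also have "(c \<star> idt (dual T \<otimes>\<^sub>o T)) \<bullet> Coevt T = (idt (A \<otimes>\<^sub>o T) \<star> Coevt T) \<bullet> c"
    using assms slide_left[of c "Coevt T" \<I> "dual T \<otimes>\<^sub>o T"] slide_right[of c "Coevt T" "A \<otimes>\<^sub>o T" \<I>] by simp
  also have "(idt A \<star> Evt T \<star> idt T) \<bullet> \<dots> = (idt A \<star> ((Evt T \<star> idt T) \<bullet> (idt T \<star> Coevt T))) \<bullet> c"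
    using assms by (simp add: idt_tens_cmp cmp_assoc flip: idt_tens_idt)
  also have "\<dots> = c"
    using assms by (simp add: zigzag idt_tens_idt)
  finally show ?thesis .
qed

text \<open>One and the same transpose \<open>h\<close> of \<open>g\<close> carries \<open>g\<close> across \<open>ev\<close> and across \<open>coev\<close> of the right
  duality: the first property characterises the left transpose, the second the right one, and
  pivotality says that they coincide.\<close>

lemma transpose_exists:
  assumes g: "arr g" "src g = U" "trg g = V"
  obtains h where "arr h" "src h = dual V" "trg h = dual U"
    "Ev V \<bullet> (idt (dual V) \<star> g) = Ev U \<bullet> (h \<star> idt U)"
    "(h \<star> idt V) \<bullet> Coevt V = (idt (dual U) \<star> g) \<bullet> Coevt U"
proof -
  have ob [simp]: "U \<in> Ob C" "V \<in> Ob C" using g by auto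
  have g_eq: "g = Arrow U (label g) V" using g by (cases g) simp
  have lab: "label g \<in> mor U V" using g arr_label by blast
  define h where "h = ((Ev V \<bullet> (idt (dual V) \<star> g)) \<star> idt (dual U)) \<bullet> (idt (dual V) \<star> Coev U)"
  define h' where "h' = (idt (dual U) \<star> Evt V) \<bullet> (((idt (dual U) \<star> g) \<bullet> Coevt U) \<star> idt (dual V))"
  have "h = ((Ev V \<star> idt (dual U)) \<bullet> ((idt (dual V) \<star> g) \<star> idt (dual U))) \<bullet> (idt (dual V) \<star> Coev U)"
    unfolding h_def using g by (simp add: whisker cmp_assoc)
  also have "\<dots> = Arrow (dual V) (ldual_mor C U V (label g)) (dual U)"
    by (subst g_eq) (simp add: arrow_defs ldual_mor_def)
  also have "\<dots> = Arrow (dual V) (rdual_mor C U V (label g)) (dual U)"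
    using lab by (simp add: dual_functors_mor)
  also have "\<dots> = ((idt (dual U) \<star> Evt V) \<bullet> ((idt (dual U) \<star> g) \<star> idt (dual V))) \<bullet> (Coevt U \<star> idt (dual V))"
    by (subst g_eq) (simp add: arrow_defs rdual_mor_def)
  also have "\<dots> = h'"
    unfolding h'_def using g by (simp add: whisker cmp_assoc)
  finally have hh': "h = h'" .
  show thesis
  proof
    show "arr h" "src h = dual V" "trg h = dual U" using g by (simp_all add: h_def)
    show "Ev V \<bullet> (idt (dual V) \<star> g) = Ev U \<bullet> (h \<star> idt U)"
      unfolding h_def using g by (subst mate_Ev) simp_all
    show "(h \<star> idt V) \<bullet> Coevt V = (idt (dual U) \<star> g) \<bullet> Coevt U"
      unfolding hh' h'_def using g by (subst mate_Coevt) simp_all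
  qed
qed

text \<open>The constraint \<open>W\<^sup>* \<otimes> V\<^sup>* \<rightarrow> (V \<otimes> W)\<^sup>*\<close> of the left duality functor turns \<open>ev\<close> of \<open>V \<otimes> W\<close> into two
  nested evaluations; that of the right one turns two nested coevaluations into the coevaluation
  of \<open>V \<otimes> W\<close>. In a pivotal category they are the same arrow, so a single \<open>h\<close> does both.\<close>

lemma dual_tens_constraint:
  assumes ob [simp]: "V \<in> Ob C" "W \<in> Ob C"
  obtains h where "arr h" "src h = dual W \<otimes>\<^sub>o dual V" "trg h = dual (V \<otimes>\<^sub>o W)"
    "Ev (V \<otimes>\<^sub>o W) \<bullet> (h \<star> idt (V \<otimes>\<^sub>o W)) = Ev W \<bullet> (idt (dual W) \<star> Ev V \<star> idt W)"
    "(h \<star> idt (V \<otimes>\<^sub>o W)) \<bullet> (idt (dual W) \<star> Coevt V \<star> idt W) \<bullet> Coevt W = Coevt (V \<otimes>\<^sub>o W)"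
proof -
  let ?X = "dual (V \<otimes>\<^sub>o W)"
  let ?WV = "dual W \<otimes>\<^sub>o dual V"
  let ?e = "Ev W \<bullet> (idt (dual W) \<star> Ev V \<star> idt W)"
  let ?c = "(idt (dual W) \<star> Coevt V \<star> idt W) \<bullet> Coevt W"
  let ?q = "Evt V \<bullet> (idt V \<star> Evt W \<star> idt (dual V))"
  define h where "h = (?e \<star> idt ?X) \<bullet> (idt ?WV \<star> Coev (V \<otimes>\<^sub>o W))"
  have "h = ((Ev W \<star> idt ?X) \<bullet> (((idt (dual W) \<star> Ev V) \<star> idt W) \<star> idt ?X))
              \<bullet> ((idt (dual W) \<star> idt (dual V)) \<star> Coev (V \<otimes>\<^sub>o W))"
    unfolding h_def by (simp add: whisker cmp_assoc flip: idt_tens_idt)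
  also have "\<dots> = Arrow ?WV (ldual_tens C V W) ?X"
    by (simp add: arrow_defs ldual_tens_def)
  also have "\<dots> = Arrow ?WV (rdual_tens C V W) ?X"
    by (simp add: dual_functors_tens)
  also have "\<dots> = ((idt ?X \<star> Evt V) \<bullet> (((idt ?X \<star> idt V) \<star> Evt W) \<star> idt (dual V)))
              \<bullet> ((Coevt (V \<otimes>\<^sub>o W) \<star> idt (dual W)) \<star> idt (dual V))"
    by (simp add: arrow_defs rdual_tens_def)
  also have "\<dots> = (idt ?X \<star> ?q) \<bullet> (Coevt (V \<otimes>\<^sub>o W) \<star> idt ?WV)"
    by (simp add: whisker cmp_assoc flip: idt_tens_idt)
  finally have h_eq: "h = \<dots>" .
  have "(h \<star> idt (V \<otimes>\<^sub>o W)) \<bullet> ?c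
      = (idt ?X \<star> ?q \<star> idt (V \<otimes>\<^sub>o W)) \<bullet> (Coevt (V \<otimes>\<^sub>o W) \<star> idt (?WV \<otimes>\<^sub>o (V \<otimes>\<^sub>o W))) \<bullet> ?c"
    unfolding h_eq by (simp add: whisker cmp_assoc flip: idt_tens_idt)
  also have "(Coevt (V \<otimes>\<^sub>o W) \<star> idt (?WV \<otimes>\<^sub>o (V \<otimes>\<^sub>o W))) \<bullet> ?c
      = (idt (?X \<otimes>\<^sub>o (V \<otimes>\<^sub>o W)) \<star> ?c) \<bullet> Coevt (V \<otimes>\<^sub>o W)"
    using slide_left[of "Coevt (V \<otimes>\<^sub>o W)" ?c \<I> "?WV \<otimes>\<^sub>o (V \<otimes>\<^sub>o W)"]
      slide_right[of "Coevt (V \<otimes>\<^sub>o W)" ?c "?X \<otimes>\<^sub>o (V \<otimes>\<^sub>o W)" \<I>] by simp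
  also have "(idt ?X \<star> ?q \<star> idt (V \<otimes>\<^sub>o W)) \<bullet> (idt (?X \<otimes>\<^sub>o (V \<otimes>\<^sub>o W)) \<star> ?c) \<bullet> Coevt (V \<otimes>\<^sub>o W)
      = (idt ?X \<star> ((?q \<star> idt (V \<otimes>\<^sub>o W)) \<bullet> (idt (V \<otimes>\<^sub>o W) \<star> ?c))) \<bullet> Coevt (V \<otimes>\<^sub>o W)"
    by (simp add: whisker cmp_assoc flip: idt_tens_idt)
  also have "(?q \<star> idt (V \<otimes>\<^sub>o W)) \<bullet> (idt (V \<otimes>\<^sub>o W) \<star> ?c) = idt (V \<otimes>\<^sub>o W)"
  proof -
    \<comment> \<open>Exchanging \<open>evt\<close> of \<open>W\<close> with the coevaluation of \<open>V\<close> separates the two nested zigzags.\<close>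
    have "(?q \<star> idt (V \<otimes>\<^sub>o W)) \<bullet> (idt (V \<otimes>\<^sub>o W) \<star> ?c)
        = (Evt V \<star> idt V \<star> idt W) \<bullet>
          (idt V \<star> ((Evt W \<star> idt (dual V \<otimes>\<^sub>o V)) \<bullet> (idt (W \<otimes>\<^sub>o dual W) \<star> Coevt V)) \<star> idt W) \<bullet>
          (idt V \<star> idt W \<star> Coevt W)"
      by (simp add: whisker cmp_assoc flip: idt_tens_idt)
    also have "(Evt W \<star> idt (dual V \<otimes>\<^sub>o V)) \<bullet> (idt (W \<otimes>\<^sub>o dual W) \<star> Coevt V) = Coevt V \<bullet> Evt W"
      using slide_left[of "Evt W" "Coevt V" "W \<otimes>\<^sub>o dual W" "dual V \<otimes>\<^sub>o V"]
        slide_right[of "Evt W" "Coevt V" \<I> \<I>] by simp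
    also have "(Evt V \<star> idt V \<star> idt W) \<bullet> (idt V \<star> (Coevt V \<bullet> Evt W) \<star> idt W) \<bullet> (idt V \<star> idt W \<star> Coevt W)
        = (((Evt V \<star> idt V) \<bullet> (idt V \<star> Coevt V)) \<star> idt W) \<bullet> (idt V \<star> ((Evt W \<star> idt W) \<bullet> (idt W \<star> Coevt W)))"
      by (simp add: whisker cmp_assoc)
    also have "\<dots> = idt (V \<otimes>\<^sub>o W)"
      by (simp add: zigzag idt_tens_idt)
    finally show ?thesis .
  qed
  also have "(idt ?X \<star> idt (V \<otimes>\<^sub>o W)) \<bullet> Coevt (V \<otimes>\<^sub>o W) = Coevt (V \<otimes>\<^sub>o W)"
    by (simp add: idt_tens_idt)
  finally have 2: "(h \<star> idt (V \<otimes>\<^sub>o W)) \<bullet> ?c = Coevt (V \<otimes>\<^sub>o W)" .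
  show thesis
  proof
    show "arr h" "src h = ?WV" "trg h = ?X" by (simp_all add: h_def)
    show "Ev (V \<otimes>\<^sub>o W) \<bullet> (h \<star> idt (V \<otimes>\<^sub>o W)) = ?e"
      unfolding h_def by (subst mate_Ev) simp_all
  qed (fact 2)
qed

definition ptraceR where
  "ptraceR V W x = (idt V \<star> Evt W) \<bullet> (x \<star> idt (dual W)) \<bullet> (idt V \<star> Coev W)"

definition ptraceL where
  "ptraceL W V x = (Ev W \<star> idt V) \<bullet> (idt (dual W) \<star> x) \<bullet> (Coevt W \<star> idt V)"

lemma ptraceR_simps [simp]:
  assumes "V \<in> Ob C" "W \<in> Ob C"
  shows "src (ptraceR V W x) = V" "trg (ptraceR V W x) = V"
    "\<lbrakk>arr x; src x = V \<otimes>\<^sub>o W; trg x = V \<otimes>\<^sub>o W\<rbrakk> \<Longrightarrow> arr (ptraceR V W x)"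
  using assms by (simp_all add: ptraceR_def)

lemma ptraceL_simps [simp]:
  assumes "V \<in> Ob C" "W \<in> Ob C"
  shows "src (ptraceL W V x) = V" "trg (ptraceL W V x) = V"
    "\<lbrakk>arr x; src x = W \<otimes>\<^sub>o V; trg x = W \<otimes>\<^sub>o V\<rbrakk> \<Longrightarrow> arr (ptraceL W V x)"
  using assms by (simp_all add: ptraceL_def)

lemma ptraceR_Arrow:
  assumes [simp]: "V \<in> Ob C" "W \<in> Ob C" and f: "f \<in> mor (V \<otimes>\<^sub>o W) (V \<otimes>\<^sub>o W)"
  shows "ptraceR V W (Arrow (V \<otimes>\<^sub>o W) f (V \<otimes>\<^sub>o W)) = Arrow V (ptrR C V W f) V"
proof -
  let ?x = "Arrow (V \<otimes>\<^sub>o W) f (V \<otimes>\<^sub>o W)"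
  have "ptraceR V W ?x = ((idt V \<star> Evt W) \<bullet> (?x \<star> idt (dual W))) \<bullet> (idt V \<star> Coev W)"
    using f by (simp add: ptraceR_def cmp_assoc)
  then show ?thesis by (simp add: arrow_defs ptrR_def)
qed

lemma ptraceL_Arrow:
  assumes [simp]: "V \<in> Ob C" "W \<in> Ob C" and f: "f \<in> mor (W \<otimes>\<^sub>o V) (W \<otimes>\<^sub>o V)"
  shows "ptraceL W V (Arrow (W \<otimes>\<^sub>o V) f (W \<otimes>\<^sub>o V)) = Arrow V (ptrL C W V f) V"
proof -
  let ?x = "Arrow (W \<otimes>\<^sub>o V) f (W \<otimes>\<^sub>o V)"
  have "ptraceL W V ?x = ((Ev W \<star> idt V) \<bullet> (idt (dual W) \<star> ?x)) \<bullet> (Coevt W \<star> idt V)"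
    using f by (simp add: ptraceL_def cmp_assoc)
  then show ?thesis by (simp add: arrow_defs ptrL_def)
qed

lemma ptraces_commute:
  assumes [simp]: "A \<in> Ob C" "S \<in> Ob C" "B \<in> Ob C" "arr x"
    "src x = A \<otimes>\<^sub>o (S \<otimes>\<^sub>o B)" "trg x = A \<otimes>\<^sub>o (S \<otimes>\<^sub>o B)"
  shows "ptraceL A S (ptraceR (A \<otimes>\<^sub>o S) B x) = ptraceR S B (ptraceL A (S \<otimes>\<^sub>o B) x)"
proof -
  let ?a = "idt (dual A \<otimes>\<^sub>o (A \<otimes>\<^sub>o S))" and ?b = "idt (S \<otimes>\<^sub>o (B \<otimes>\<^sub>o dual B))"
  have 1: "(Ev A \<star> idt S) \<bullet> (?a \<star> Evt B) = (idt S \<star> Evt B) \<bullet> (Ev A \<star> ?b)"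
    using slide_left[of "Ev A \<star> idt S" "Evt B" "dual A \<otimes>\<^sub>o (A \<otimes>\<^sub>o S)" \<I>]
      slide_right[of "Ev A" "idt S \<star> Evt B" \<I> "S \<otimes>\<^sub>o (B \<otimes>\<^sub>o dual B)"] by simp
  have 2: "(?a \<star> Coev B) \<bullet> (Coevt A \<star> idt S) = (Coevt A \<star> ?b) \<bullet> (idt S \<star> Coev B)"
    using slide_left[of "Coevt A" "idt S \<star> Coev B" \<I> "S \<otimes>\<^sub>o (B \<otimes>\<^sub>o dual B)"]
      slide_right[of "Coevt A \<star> idt S" "Coev B" "dual A \<otimes>\<^sub>o (A \<otimes>\<^sub>o S)" \<I>] by simp
  have "ptraceL A S (ptraceR (A \<otimes>\<^sub>o S) B x) = ((Ev A \<star> idt S) \<bullet> (?a \<star> Evt B)) \<bullet>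
      (idt (dual A) \<star> x \<star> idt (dual B)) \<bullet> ((?a \<star> Coev B) \<bullet> (Coevt A \<star> idt S))"
    by (simp add: ptraceL_def ptraceR_def whisker cmp_assoc flip: idt_tens_idt)
  also have "\<dots> = ptraceR S B (ptraceL A (S \<otimes>\<^sub>o B) x)"
    unfolding 1 2 by (simp add: ptraceL_def ptraceR_def whisker cmp_assoc flip: idt_tens_idt)
  finally show ?thesis .
qed

text \<open>Closing the right strand of \<open>V\<^sup>* \<otimes> V \<rightarrow> \<I> \<rightarrow> V\<^sup>* \<otimes> V\<close> straightens to the identity by one zigzag of each
  duality. This is where the double dual is avoided: the arrow has \<open>V\<close>, not \<open>V\<^sup>*\<close>, on the strand
  that is closed.\<close>

lemma ptraceR_coevt_ev:
  assumes [simp]: "V \<in> Ob C"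
  shows "ptraceR (dual V) V (Coevt V \<bullet> Ev V) = idt (dual V)"
proof -
  have "ptraceR (dual V) V (Coevt V \<bullet> Ev V)
      = ((idt (dual V) \<star> Evt V) \<bullet> (Coevt V \<star> idt (dual V))) \<bullet> ((Ev V \<star> idt (dual V)) \<bullet> (idt (dual V) \<star> Coev V))"
    by (simp add: ptraceR_def whisker cmp_assoc)
  also have "\<dots> = idt (dual V)" by (simp add: zigzag)
  finally show ?thesis .
qed

section \<open>Projective objects in a pivotal category\<close>

definition epic :: "('o, 'm) arrow \<Rightarrow> bool" where
  "epic e \<longleftrightarrow> arr e \<and>
    (\<forall>f g. arr f \<and> arr g \<and> src f = trg e \<and> src g = trg e \<and> trg f = trg g \<and> f \<bullet> e = g \<bullet> e \<longrightarrow> f = g)"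

lemma epicD:
  "\<lbrakk>epic e; arr f; arr g; src f = trg e; src g = trg e; trg f = trg g; f \<bullet> e = g \<bullet> e\<rbrakk> \<Longrightarrow> f = g"
  by (auto simp: epic_def)

lemma epic_iff_epi: "arr e \<Longrightarrow> epic e \<longleftrightarrow> epi C (src e) (trg e) (label e)"
proof (intro iffI)
  assume e: "arr e" "epic e"
  show "epi C (src e) (trg e) (label e)"
    unfolding epi_def
  proof (intro conjI ballI impI)
    show "label e \<in> mor (src e) (trg e)" using e(1) by (rule arr_label)
    fix Z f g assume *: "Z \<in> Ob C" "f \<in> mor (trg e) Z" "g \<in> mor (trg e) Z" "f \<cdot> label e = g \<cdot> label e"
    have "Arrow (trg e) f Z = Arrow (trg e) g Z"
      by (rule epicD[OF e(2)]) (use * e(1) in \<open>simp_all add: cmp_def\<close>)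
    then show "f = g" by simp
  qed
next
  assume e: "arr e" "epi C (src e) (trg e) (label e)"
  show "epic e"
    unfolding epic_def
  proof (intro conjI allI impI)
    fix f g
    assume *: "arr f \<and> arr g \<and> src f = trg e \<and> src g = trg e \<and> trg f = trg g \<and> f \<bullet> e = g \<bullet> e"
    then have "label f \<in> mor (trg e) (trg f)" "label g \<in> mor (trg e) (trg f)" "trg f \<in> Ob C"
      using arr_label[of f] arr_label[of g] by auto
    moreover from * have "label f \<cdot> label e = label g \<cdot> label e" by (simp add: cmp_def)
    ultimately have "label f = label g" using e(2) unfolding epi_def by blast
    then show "f = g" using * by (cases f; cases g) auto
  qed (fact e(1))
qed

lemma Proj_lift:
  assumes "P \<in> Proj C" "epic e" "arr y" "src y = P" "trg y = trg e"
  obtains k where "arr k" "src k = P" "trg k = src e" "e \<bullet> k = y"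
proof -
  have e: "arr e" using assms(2) by (simp add: epic_def)
  have "label y \<in> mor P (trg e)" using arr_label[OF assms(3)] assms(4,5) by simp
  moreover have "(\<lambda>f. label e \<cdot> f) ` mor P (src e) = mor P (trg e)"
    using assms(1) epic_iff_epi[OF e] assms(2) e unfolding Proj_def by auto
  ultimately obtain k where k: "k \<in> mor P (src e)" "label y = label e \<cdot> k" by auto
  show thesis
  proof
    show "arr (Arrow P k (src e))" using k e assms by auto
    show "e \<bullet> Arrow P k (src e) = y" using k(2) assms(4,5) by (cases y) (simp add: cmp_def)
  qed simp_all
qed

lemma ProjI:
  assumes P: "P \<in> Ob C"
    and lift: "\<And>e y. \<lbrakk>epic e; arr y; src y = P; trg y = trg e\<rbrakk>
      \<Longrightarrow> \<exists>k. arr k \<and> src k = P \<and> trg k = src e \<and> e \<bullet> k = y"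
  shows "P \<in> Proj C"
  unfolding Proj_def
proof (intro CollectI conjI ballI allI impI P)
  fix A B e assume AB: "A \<in> Ob C" "B \<in> Ob C" and e: "epi C A B e"
  have e_mor: "e \<in> mor A B" using e by (simp add: epi_def)
  have epic: "epic (Arrow A e B)" using AB e e_mor by (simp add: epic_iff_epi)
  show "(\<lambda>f. e \<cdot> f) ` mor P A = mor P B"
  proof (intro subset_antisym subsetI)
    fix y assume y: "y \<in> mor P B"
    obtain k where k: "arr k" "src k = P" "trg k = A" "Arrow A e B \<bullet> k = Arrow P y B"
      using lift[OF epic, of "Arrow P y B"] P AB y by auto
    show "y \<in> (\<lambda>f. e \<cdot> f) ` mor P A"
      using k arr_label[OF k(1)] by (auto simp: cmp_def)
  qed (use AB P e_mor Comp_closed in blast)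
qed

text \<open>\<open>W\<^sup>* \<otimes> -\<close> is left adjoint to \<open>W \<otimes> -\<close>, and left adjoints preserve epimorphisms.\<close>

lemma epic_idt_tens:
  assumes e: "epic e" and W [simp]: "W \<in> Ob C"
  shows "epic (idt (dual W) \<star> e)"
proof -
  have [simp]: "arr e" using e by (simp add: epic_def)
  let ?A = "src e" and ?B = "trg e"
  \<comment> \<open>The adjunct \<open>B \<rightarrow> W \<otimes> Z\<close> of \<open>f : W\<^sup>* \<otimes> B \<rightarrow> Z\<close>, from which \<open>f\<close> is recovered in \<open>adj_inv\<close>.\<close>
  let ?adj = "\<lambda>f. (idt W \<star> f) \<bullet> (Coev W \<star> idt ?B)"
  have adj_cmp: "?adj f \<bullet> e = (idt W \<star> (f \<bullet> (idt (dual W) \<star> e))) \<bullet> (Coev W \<star> idt ?A)"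
    if [simp]: "arr f" "src f = dual W \<otimes>\<^sub>o ?B" for f
  proof -
    have "?adj f \<bullet> e = (idt W \<star> f) \<bullet> ((Coev W \<star> idt ?B) \<bullet> e)"
      by (simp add: cmp_assoc)
    also have "(Coev W \<star> idt ?B) \<bullet> e = (idt (W \<otimes>\<^sub>o dual W) \<star> e) \<bullet> (Coev W \<star> idt ?A)"
      using slide_left[of "Coev W" e \<I> ?B] slide_right[of "Coev W" e "W \<otimes>\<^sub>o dual W" ?A] by simp
    finally show ?thesis by (simp add: whisker cmp_assoc flip: idt_tens_idt)
  qed
  have adj_inv: "(Ev W \<star> idt (trg f)) \<bullet> (idt (dual W) \<star> ?adj f) = f"
    if [simp]: "arr f" "src f = dual W \<otimes>\<^sub>o ?B" for f
  proof -
    have "(Ev W \<star> idt (trg f)) \<bullet> (idt (dual W) \<star> ?adj f)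
        = ((Ev W \<star> idt (trg f)) \<bullet> (idt (dual W \<otimes>\<^sub>o W) \<star> f)) \<bullet> (idt (dual W) \<star> Coev W \<star> idt ?B)"
      by (simp add: whisker cmp_assoc flip: idt_tens_idt)
    also have "(Ev W \<star> idt (trg f)) \<bullet> (idt (dual W \<otimes>\<^sub>o W) \<star> f) = f \<bullet> (Ev W \<star> idt (dual W) \<star> idt ?B)"
      using slide_left[of "Ev W" f "dual W \<otimes>\<^sub>o W" "trg f"]
        slide_right[of "Ev W" f \<I> "dual W \<otimes>\<^sub>o ?B"] by (simp flip: idt_tens_idt)
    also have "\<dots> \<bullet> (idt (dual W) \<star> Coev W \<star> idt ?B)
        = f \<bullet> (((Ev W \<star> idt (dual W)) \<bullet> (idt (dual W) \<star> Coev W)) \<star> idt ?B)"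
      by (simp add: whisker cmp_assoc)
    also have "\<dots> = f" by (simp add: zigzag idt_tens_idt)
    finally show ?thesis .
  qed
  show ?thesis
    unfolding epic_def
  proof (intro conjI allI impI)
    fix f g assume *: "arr f \<and> arr g \<and> src f = trg (idt (dual W) \<star> e) \<and> src g = trg (idt (dual W) \<star> e) \<and>
      trg f = trg g \<and> f \<bullet> (idt (dual W) \<star> e) = g \<bullet> (idt (dual W) \<star> e)"
    then have f: "arr f" "src f = dual W \<otimes>\<^sub>o ?B" and g: "arr g" "src g = dual W \<otimes>\<^sub>o ?B"
      and fg: "trg f = trg g" "f \<bullet> (idt (dual W) \<star> e) = g \<bullet> (idt (dual W) \<star> e)" by simp_all
    have "?adj f \<bullet> e = ?adj g \<bullet> e"
      unfolding adj_cmp[OF f] adj_cmp[OF g] fg(2) ..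
    then have "?adj f = ?adj g"
      by (rule epicD[OF e, rotated -1]) (use f g fg(1) in simp_all)
    then have "(Ev W \<star> idt (trg f)) \<bullet> (idt (dual W) \<star> ?adj f) = (Ev W \<star> idt (trg g)) \<bullet> (idt (dual W) \<star> ?adj g)"
      using fg(1) by (simp only:)
    then show "f = g" unfolding adj_inv[OF f] adj_inv[OF g] .
  qed simp
qed

text \<open>\<open>Hom(W \<otimes> P, -)\<close> is \<open>Hom(P, W\<^sup>* \<otimes> -)\<close>, a composite of two functors that preserve epimorphisms.\<close>

lemma tens_Proj:
  assumes P: "P \<in> Proj C" and W [simp]: "W \<in> Ob C"
  shows "W \<otimes>\<^sub>o P \<in> Proj C"
proof (rule ProjI)
  have [simp]: "P \<in> Ob C" using P by (simp add: Proj_def)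
  then show "W \<otimes>\<^sub>o P \<in> Ob C" by simp
  fix e y assume e: "epic e" and [simp]: "arr y" "src y = W \<otimes>\<^sub>o P" "trg y = trg e"
  have [simp]: "arr e" using e by (simp add: epic_def)
  \<comment> \<open>\<open>z\<close> is the adjunct of \<open>y\<close>; its lift \<open>k\<close> through \<open>W\<^sup>* \<otimes> e\<close> is transposed back to a lift of \<open>y\<close>.\<close>
  define z where "z = (idt (dual W) \<star> y) \<bullet> (Coevt W \<star> idt P)"
  have z: "arr z" "src z = P" "trg z = trg (idt (dual W) \<star> e)" by (simp_all add: z_def)
  obtain k where [simp]: "arr k" "src k = P" "trg k = dual W \<otimes>\<^sub>o src e"
    and k: "(idt (dual W) \<star> e) \<bullet> k = z"
    using Proj_lift[OF P epic_idt_tens[OF e W] z] by auto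
  let ?k = "(Evt W \<star> idt (src e)) \<bullet> (idt W \<star> k)"
  have "e \<bullet> ?k = (e \<bullet> (Evt W \<star> idt (src e))) \<bullet> (idt W \<star> k)"
    by (simp add: cmp_assoc)
  also have "e \<bullet> (Evt W \<star> idt (src e)) = (Evt W \<star> idt (trg e)) \<bullet> (idt (W \<otimes>\<^sub>o dual W) \<star> e)"
    using slide_right[of "Evt W" e \<I> "src e"] slide_left[of "Evt W" e "W \<otimes>\<^sub>o dual W" "trg e"] by simp
  also have "\<dots> \<bullet> (idt W \<star> k) = (Evt W \<star> idt (trg e)) \<bullet> (idt W \<star> z)"
    unfolding k[symmetric] by (simp add: whisker cmp_assoc flip: idt_tens_idt)
  also have "\<dots> = ((Evt W \<star> idt (trg e)) \<bullet> (idt (W \<otimes>\<^sub>o dual W) \<star> y)) \<bullet> (idt W \<star> Coevt W \<star> idt P)"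
    unfolding z_def by (simp add: whisker cmp_assoc flip: idt_tens_idt)
  also have "(Evt W \<star> idt (trg e)) \<bullet> (idt (W \<otimes>\<^sub>o dual W) \<star> y) = y \<bullet> (Evt W \<star> idt W \<star> idt P)"
    using slide_right[of "Evt W" y \<I> "W \<otimes>\<^sub>o P"] slide_left[of "Evt W" y "W \<otimes>\<^sub>o dual W" "trg e"]
    by (simp flip: idt_tens_idt)
  also have "\<dots> \<bullet> (idt W \<star> Coevt W \<star> idt P) = y \<bullet> (((Evt W \<star> idt W) \<bullet> (idt W \<star> Coevt W)) \<star> idt P)"
    by (simp add: whisker cmp_assoc)
  also have "\<dots> = y" by (simp add: zigzag idt_tens_idt)
  finally show "\<exists>k. arr k \<and> src k = W \<otimes>\<^sub>o P \<and> trg k = src e \<and> e \<bullet> k = y"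
    by (intro exI[of _ ?k]) simp
qed

lemma retract_ofI:
  assumes "arr a" "arr b" "src a = V" "trg a = W" "src b = W" "trg b = V" "b \<bullet> a = idt V"
  shows "retract_of C V W"
  using assms arr_label[of a] arr_label[of b]
  by (auto simp: retract_of_def retract_via_def cmp_def idt_def)

lemma retract_of_epic:
  assumes "P \<in> Proj C" "epic e" "trg e = P"
  shows "retract_of C P (src e)"
proof -
  have [simp]: "P \<in> Ob C" "arr e" using assms by (auto simp: Proj_def epic_def)
  obtain k where "arr k" "src k = P" "trg k = src e" "e \<bullet> k = idt P"
    by (rule Proj_lift[OF assms(1,2), of "idt P"]) (use assms in auto)
  then show ?thesis using assms(3) by (intro retract_ofI) simp_all
qed

lemma faithful_tensorD:
  assumes "faithful_tensor C Q" "arr f" "arr g" "src f = src g" "trg f = trg g"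
  shows "idt Q \<star> f = idt Q \<star> g \<Longrightarrow> f = g" "f \<star> idt Q = g \<star> idt Q \<Longrightarrow> f = g"
proof -
  have "label f \<in> mor (src g) (trg g)" "label g \<in> mor (src g) (trg g)" "src g \<in> Ob C" "trg g \<in> Ob C"
    using assms arr_label[of f] arr_label[of g] by auto
  then have "Idm Q \<otimes>\<^sub>m label f = Idm Q \<otimes>\<^sub>m label g \<Longrightarrow> label f = label g"
    "label f \<otimes>\<^sub>m Idm Q = label g \<otimes>\<^sub>m Idm Q \<Longrightarrow> label f = label g"
    using assms(1) unfolding faithful_tensor_def inj_on_def by blast+
  then show "idt Q \<star> f = idt Q \<star> g \<Longrightarrow> f = g" "f \<star> idt Q = g \<star> idt Q \<Longrightarrow> f = g"
    using assms(4,5) by (cases f; cases g; simp add: tens_def idt_def)+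
qed

text \<open>Faithfulness of \<open>Q \<otimes> -\<close> makes \<open>ev\<^sub>Q \<otimes> P : Q\<^sup>* \<otimes> Q \<otimes> P \<rightarrow> P\<close> an epimorphism, because \<open>Q \<otimes> f\<close> can be
  recovered from \<open>f \<circ> (ev\<^sub>Q \<otimes> P)\<close>; it splits as \<open>P\<close> is projective.\<close>

lemma Proj_retract_left:
  assumes P: "P \<in> Proj C" and Q [simp]: "Q \<in> Ob C" and faithful: "faithful_tensor C Q"
  shows "retract_of C P (dual Q \<otimes>\<^sub>o (Q \<otimes>\<^sub>o P))"
proof -
  have [simp]: "P \<in> Ob C" using P by (simp add: Proj_def)
  let ?e = "Ev Q \<star> idt P"
  have recover: "idt Q \<star> f = (idt Q \<star> (f \<bullet> ?e)) \<bullet> (Coev Q \<star> idt Q \<star> idt P)"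
    if [simp]: "arr f" "src f = P" for f
  proof -
    have "(idt Q \<star> (f \<bullet> ?e)) \<bullet> (Coev Q \<star> idt Q \<star> idt P)
        = (idt Q \<star> f) \<bullet> (((idt Q \<star> Ev Q) \<bullet> (Coev Q \<star> idt Q)) \<star> idt P)"
      by (simp add: whisker cmp_assoc)
    then show ?thesis by (simp add: zigzag idt_tens_idt)
  qed
  have "epic ?e"
    unfolding epic_def
  proof (intro conjI allI impI)
    fix f g assume *: "arr f \<and> arr g \<and> src f = trg ?e \<and> src g = trg ?e \<and> trg f = trg g \<and> f \<bullet> ?e = g \<bullet> ?e"
    then have "idt Q \<star> f = idt Q \<star> g" using recover[of f] recover[of g] by simp
    then show "f = g" using faithful_tensorD(1)[OF faithful] * by simp
  qed simp
  from retract_of_epic[OF P this] show ?thesis by simp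
qed

lemma Proj_retract_right:
  assumes P: "P \<in> Proj C" and Q [simp]: "Q \<in> Ob C" and faithful: "faithful_tensor C Q"
  shows "retract_of C P (P \<otimes>\<^sub>o (Q \<otimes>\<^sub>o dual Q))"
proof -
  have [simp]: "P \<in> Ob C" using P by (simp add: Proj_def)
  let ?e = "idt P \<star> Evt Q"
  have recover: "f \<star> idt Q = ((f \<bullet> ?e) \<star> idt Q) \<bullet> (idt P \<star> idt Q \<star> Coevt Q)"
    if [simp]: "arr f" "src f = P" for f
  proof -
    have "((f \<bullet> ?e) \<star> idt Q) \<bullet> (idt P \<star> idt Q \<star> Coevt Q)
        = (f \<star> idt Q) \<bullet> (idt P \<star> ((Evt Q \<star> idt Q) \<bullet> (idt Q \<star> Coevt Q)))"
      by (simp add: whisker cmp_assoc)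
    then show ?thesis by (simp add: zigzag idt_tens_idt)
  qed
  have "epic ?e"
    unfolding epic_def
  proof (intro conjI allI impI)
    fix f g assume *: "arr f \<and> arr g \<and> src f = trg ?e \<and> src g = trg ?e \<and> trg f = trg g \<and> f \<bullet> ?e = g \<bullet> ?e"
    then have "f \<star> idt Q = g \<star> idt Q" using recover[of f] recover[of g] by simp
    then show "f = g" using faithful_tensorD(2)[OF faithful] * by simp
  qed simp
  from retract_of_epic[OF P this] show ?thesis by simp
qed

lemma left_ideal_Proj:
  assumes "right_ideal C (Proj C)"
  shows "left_ideal C (Proj C)"
  using assms tens_Proj unfolding left_ideal_def right_ideal_def by blast

text \<open>The zigzag identity for \<open>P\<^sup>*\<close> exhibits it as a retract of \<open>P\<^sup>* \<otimes> P \<otimes> P\<^sup>*\<close>.\<close>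

lemma dual_Proj:
  assumes ideal: "right_ideal C (Proj C)" and P: "P \<in> Proj C"
  shows "dual P \<in> Proj C"
proof -
  have [simp]: "P \<in> Ob C" using P by (simp add: Proj_def)
  have "retract_of C (dual P) (dual P \<otimes>\<^sub>o (P \<otimes>\<^sub>o dual P))"
    by (rule retract_ofI[of "idt (dual P) \<star> Coev P" "Ev P \<star> idt (dual P)"]) (simp_all add: zigzag)
  moreover have "P \<otimes>\<^sub>o dual P \<in> Proj C"
    using ideal P by (simp add: right_ideal_def)
  then have "dual P \<otimes>\<^sub>o (P \<otimes>\<^sub>o dual P) \<in> Proj C"
    by (rule tens_Proj) simp
  ultimately show ?thesis using ideal unfolding right_ideal_def by blast
qed

end

section \<open>The dual of a right trace\<close>

definition value_at where
  "value_at t x = t (src x) (label x)"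

lemma linear_forms_eq_finsum:
  assumes "module R M" "linear_form R M \<phi>" "linear_form R M \<psi>" "finite A" "g \<in> A \<rightarrow> carrier M"
    and "\<And>i. i \<in> A \<Longrightarrow> \<phi> (g i) = \<psi> (g i)"
  shows "\<phi> (finsum M g A) = \<psi> (finsum M g A)"
proof -
  interpret module R M by fact
  have zero: "\<chi> \<zero>\<^bsub>M\<^esub> = \<zero>\<^bsub>R\<^esub>" if \<chi>: "linear_form R M \<chi>" for \<chi>
  proof -
    have "\<chi> (\<zero>\<^bsub>R\<^esub> \<odot>\<^bsub>M\<^esub> \<zero>\<^bsub>M\<^esub>) = \<zero>\<^bsub>R\<^esub> \<otimes>\<^bsub>R\<^esub> \<chi> \<zero>\<^bsub>M\<^esub>" "\<chi> \<zero>\<^bsub>M\<^esub> \<in> carrier R"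
      using \<chi> M.zero_closed R.zero_closed unfolding linear_form_def by blast+
    then show ?thesis by simp
  qed
  show ?thesis
    using assms(4-6)
  proof (induction A rule: finite_induct)
    case empty
    then show ?case by (simp add: zero[OF assms(2)] zero[OF assms(3)])
  next
    case (insert a A)
    then have "finsum M g A \<in> carrier M" "g a \<in> carrier M"
      "finsum M g (insert a A) = g a \<oplus>\<^bsub>M\<^esub> finsum M g A"
      by (auto intro!: M.finsum_closed simp: Pi_def)
    then show ?case using insert assms(2,3) unfolding linear_form_def by simp
  qed
qed

context pivotal_k_category
begin

lemma cyclic_familyD:
  assumes "cyclic_linear_family R C I t" "arr x" "arr y" "src x = trg y" "src y = trg x"
    "src x \<in> I" "trg x \<in> I"
  shows "value_at t (x \<bullet> y) = value_at t (y \<bullet> x)"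
proof -
  have "label y \<in> mor (trg x) (src x)" "label x \<in> mor (src x) (trg x)"
    using assms arr_label[of x] arr_label[of y] by auto
  then have "t (trg x) (label x \<cdot> label y) = t (src x) (label y \<cdot> label x)"
    using assms(1,6,7) unfolding cyclic_linear_family_def by blast
  then show ?thesis using assms(4,5) by (simp add: value_at_def cmp_def)
qed

lemma right_traceD:
  assumes "right_trace R C I t" "U \<in> I" "W \<in> Ob C" "arr x" "src x = U \<otimes>\<^sub>o W" "trg x = U \<otimes>\<^sub>o W"
  shows "value_at t x = value_at t (ptraceR U W x)"
proof -
  have "U \<in> Ob C" using assms by (auto simp: right_trace_def right_ideal_def)
  moreover have "label x \<in> mor (U \<otimes>\<^sub>o W) (U \<otimes>\<^sub>o W)" "x = Arrow (U \<otimes>\<^sub>o W) (label x) (U \<otimes>\<^sub>o W)"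
    using assms(4-6) arr_label[of x] by (auto, cases x, auto)
  moreover from this have "t (U \<otimes>\<^sub>o W) (label x) = t U (ptrR C U W (label x))"
    using assms(1-3) unfolding right_trace_def by blast
  ultimately show ?thesis
    using assms(3) ptraceR_Arrow[of U W "label x"] by (metis arrow.sel(1,2) value_at_def)
qed

text \<open>For a right trace \<open>t\<close> this is \<open>f \<mapsto> t(f\<^sup>*)\<close> on \<open>V\<^sup>*\<close>: taking the right partial trace over \<open>V\<close> turns the
  argument of \<open>t\<close> into the transpose \<open>f\<^sup>*\<close>. Evaluating \<open>t\<close> on \<open>V\<^sup>* \<otimes> V\<close> instead keeps double duals
  and the pivotal isomorphism out of all computations.\<close>

definition dual_trace :: "('o \<Rightarrow> 'm \<Rightarrow> 'k) \<Rightarrow> 'o \<Rightarrow> 'm \<Rightarrow> 'k" where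
  "dual_trace t V f = t (dual V \<otimes>\<^sub>o V) (coevt V \<cdot> (ev V \<cdot> (Idm (dual V) \<otimes>\<^sub>m f)))"

lemma value_at_dual_trace:
  "value_at (dual_trace t) x = value_at t (Coevt (src x) \<bullet> Ev (src x) \<bullet> (idt (dual (src x)) \<star> x))"
  by (simp add: value_at_def dual_trace_def arrow_defs)

text \<open>\<open>y\<close> travels once around: it is pushed through \<open>ev\<close> onto the dual strand, where it slides past \<open>x\<close>,
  is rotated to the other side of \<open>t\<close>, and returns through the coevaluation to the far side of \<open>x\<close>.\<close>

lemma dual_trace_commute:
  assumes t: "cyclic_linear_family R C I t" and I: "left_ideal C I"
    and [simp]: "arr x" "arr y" "src x = V" "trg x = U" "src y = U" "trg y = V"
    and UV: "U \<in> I" "V \<in> I"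
  shows "value_at (dual_trace t) (y \<bullet> x) = value_at (dual_trace t) (x \<bullet> y)"
proof -
  have [simp]: "U \<in> Ob C" "V \<in> Ob C" using UV I by (auto simp: left_ideal_def)
  have [simp]: "A \<otimes>\<^sub>o U \<in> I" "A \<otimes>\<^sub>o V \<in> I" if "A \<in> Ob C" for A
    using that UV I by (auto simp: left_ideal_def)
  obtain h where [simp]: "arr h" "src h = dual V" "trg h = dual U"
    and h_Ev: "Ev V \<bullet> (idt (dual V) \<star> y) = Ev U \<bullet> (h \<star> idt U)"
    and h_Coevt: "(h \<star> idt V) \<bullet> Coevt V = (idt (dual U) \<star> y) \<bullet> Coevt U"
    by (rule transpose_exists[of y U V]) simp_all
  have h_x: "(h \<star> idt U) \<bullet> (idt (dual V) \<star> x) = (idt (dual U) \<star> x) \<bullet> (h \<star> idt V)"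
    using slide_left[of h x "dual V" U] slide_right[of h x "dual U" V] by simp
  have "Coevt V \<bullet> Ev V \<bullet> (idt (dual V) \<star> (y \<bullet> x)) = Coevt V \<bullet> (Ev V \<bullet> (idt (dual V) \<star> y)) \<bullet> (idt (dual V) \<star> x)"
    by (simp add: whisker cmp_assoc)
  also have "\<dots> = Coevt V \<bullet> Ev U \<bullet> ((h \<star> idt U) \<bullet> (idt (dual V) \<star> x))"
    unfolding h_Ev by (simp add: cmp_assoc)
  also have "\<dots> = (Coevt V \<bullet> Ev U \<bullet> (idt (dual U) \<star> x)) \<bullet> (h \<star> idt V)"
    unfolding h_x by (simp add: cmp_assoc)
  finally have "value_at (dual_trace t) (y \<bullet> x) = value_at t ((Coevt V \<bullet> Ev U \<bullet> (idt (dual U) \<star> x)) \<bullet> (h \<star> idt V))"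
    by (simp add: value_at_dual_trace)
  also have "\<dots> = value_at t ((h \<star> idt V) \<bullet> (Coevt V \<bullet> Ev U \<bullet> (idt (dual U) \<star> x)))"
    by (rule cyclic_familyD[OF t]) simp_all
  also have "(h \<star> idt V) \<bullet> (Coevt V \<bullet> Ev U \<bullet> (idt (dual U) \<star> x))
      = ((h \<star> idt V) \<bullet> Coevt V) \<bullet> Ev U \<bullet> (idt (dual U) \<star> x)"
    by (simp add: cmp_assoc)
  also have "\<dots> = (idt (dual U) \<star> y) \<bullet> (Coevt U \<bullet> Ev U \<bullet> (idt (dual U) \<star> x))"
    unfolding h_Coevt by (simp add: cmp_assoc)
  also have "value_at t \<dots> = value_at t ((Coevt U \<bullet> Ev U \<bullet> (idt (dual U) \<star> x)) \<bullet> (idt (dual U) \<star> y))"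
    by (rule cyclic_familyD[OF t]) simp_all
  also have "\<dots> = value_at (dual_trace t) (x \<bullet> y)"
    by (simp add: value_at_dual_trace whisker cmp_assoc)
  finally show ?thesis .
qed

text \<open>Unfolding \<open>ev\<close> and \<open>coev\<close> of \<open>W \<otimes> U\<close> into nested ones,
  and moving the outer part around the trace, leaves exactly the left partial trace over \<open>W\<close>.\<close>

lemma dual_trace_ptraceL:
  assumes t: "cyclic_linear_family R C I t" and I: "left_ideal C I" and U: "U \<in> I" and [simp]: "W \<in> Ob C"
    and [simp]: "arr x" "src x = W \<otimes>\<^sub>o U" "trg x = W \<otimes>\<^sub>o U"
  shows "value_at (dual_trace t) x = value_at (dual_trace t) (ptraceL W U x)"
proof -
  have [simp]: "U \<in> Ob C" using U I by (auto simp: left_ideal_def)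
  have [simp]: "A \<otimes>\<^sub>o U \<in> I" if "A \<in> Ob C" for A
    using that U I by (auto simp: left_ideal_def)
  have [simp]: "A \<otimes>\<^sub>o (W \<otimes>\<^sub>o U) \<in> I" if "A \<in> Ob C" for A
    using that I by (auto simp: left_ideal_def)
  let ?T = "W \<otimes>\<^sub>o U"
  let ?c = "idt (dual U) \<star> Coevt W \<star> idt U"
  obtain h where [simp]: "arr h" "src h = dual U \<otimes>\<^sub>o dual W" "trg h = dual ?T"
    and h_Ev: "Ev ?T \<bullet> (h \<star> idt ?T) = Ev U \<bullet> (idt (dual U) \<star> Ev W \<star> idt U)"
    and h_Coevt: "(h \<star> idt ?T) \<bullet> ?c \<bullet> Coevt U = Coevt ?T"
    by (rule dual_tens_constraint[of W U]) simp_all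
  have h_x: "(idt (dual ?T) \<star> x) \<bullet> (h \<star> idt ?T) = (h \<star> idt ?T) \<bullet> (idt (dual U \<otimes>\<^sub>o dual W) \<star> x)"
    using slide_right[of h x "dual ?T" ?T] slide_left[of h x "dual U \<otimes>\<^sub>o dual W" ?T] by simp
  have "value_at (dual_trace t) x = value_at t (Coevt ?T \<bullet> Ev ?T \<bullet> (idt (dual ?T) \<star> x))"
    by (simp add: value_at_dual_trace)
  also have "Coevt ?T \<bullet> Ev ?T \<bullet> (idt (dual ?T) \<star> x)
      = ((h \<star> idt ?T) \<bullet> ?c) \<bullet> (Coevt U \<bullet> Ev ?T \<bullet> (idt (dual ?T) \<star> x))"
    unfolding h_Coevt[symmetric] by (simp add: cmp_assoc)
  also have "value_at t \<dots> = value_at t ((Coevt U \<bullet> Ev ?T \<bullet> (idt (dual ?T) \<star> x)) \<bullet> ((h \<star> idt ?T) \<bullet> ?c))"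
    by (rule cyclic_familyD[OF t]) simp_all
  also have "(Coevt U \<bullet> Ev ?T \<bullet> (idt (dual ?T) \<star> x)) \<bullet> ((h \<star> idt ?T) \<bullet> ?c)
      = Coevt U \<bullet> Ev ?T \<bullet> ((idt (dual ?T) \<star> x) \<bullet> (h \<star> idt ?T)) \<bullet> ?c"
    by (simp add: cmp_assoc)
  also have "\<dots> = Coevt U \<bullet> (Ev ?T \<bullet> (h \<star> idt ?T)) \<bullet> (idt (dual U \<otimes>\<^sub>o dual W) \<star> x) \<bullet> ?c"
    unfolding h_x by (simp add: cmp_assoc)
  also have "\<dots> = Coevt U \<bullet> Ev U \<bullet> (idt (dual U) \<star> ptraceL W U x)"
    unfolding h_Ev by (simp add: ptraceL_def whisker cmp_assoc flip: idt_tens_idt)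
  also have "value_at t \<dots> = value_at (dual_trace t) (ptraceL W U x)"
    by (simp add: value_at_dual_trace)
  finally show ?thesis .
qed

lemma mdim_dual_trace:
  assumes t: "right_trace R C I t" and V: "V \<in> Ob C" "dual V \<in> I"
  shows "mdim C (dual_trace t) V = mdim C t (dual V)"
proof -
  note [simp] = V(1)
  have "mdim C (dual_trace t) V = value_at (dual_trace t) (idt V)"
    by (simp add: mdim_def value_at_def idt_def)
  also have "\<dots> = value_at t (Coevt V \<bullet> Ev V)"
    by (simp add: value_at_dual_trace idt_tens_idt)
  also have "\<dots> = value_at t (ptraceR (dual V) V (Coevt V \<bullet> Ev V))"
    by (rule right_traceD[OF t]) (simp_all add: V)
  also have "\<dots> = mdim C t (dual V)"
    by (simp add: ptraceR_coevt_ev mdim_def value_at_def idt_def)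
  finally show ?thesis .
qed

lemma linear_form_dual_trace:
  assumes t: "linear_form R (Hom C (dual V \<otimes>\<^sub>o V) (dual V \<otimes>\<^sub>o V)) (t (dual V \<otimes>\<^sub>o V))"
    and V [simp]: "V \<in> Ob C"
  shows "linear_form R (Hom C V V) (dual_trace t V)"
proof -
  let ?D = "dual V" and ?T = "dual V \<otimes>\<^sub>o V"
  have clos: "Idm ?D \<otimes>\<^sub>m f \<in> mor ?T ?T" if "f \<in> mor V V" for f
    using that by (intro tens_mor_closed) (simp_all add: Idm_closed)
  have clos2: "ev V \<cdot> f \<in> mor ?T \<I>" if "f \<in> mor ?T ?T" for f
    using that by (intro Comp_closed[of ?T ?T \<I>]) (simp_all add: ev_closed)
  have clos3: "coevt V \<cdot> f \<in> mor ?T ?T" if "f \<in> mor ?T \<I>" for f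
    using that by (intro Comp_closed[of ?T \<I> ?T]) (simp_all add: coevt_closed)
  note clos = clos clos2 clos3
  note lin = tens_add_right[of ?D ?D V V] tens_smult_right[of ?D ?D V V] Idm_closed
    Comp_add_right[of ?T ?T \<I>] Comp_smult_right[of ?T ?T \<I>] ev_closed
    Comp_add_right[of ?T \<I> ?T] Comp_smult_right[of ?T \<I> ?T] coevt_closed
  from t show ?thesis
    unfolding linear_form_def dual_trace_def by (simp add: Pi_iff clos lin)
qed

lemma cyclic_linear_dual_trace:
  assumes t: "cyclic_linear_family R C I t" and I: "left_ideal C I"
  shows "cyclic_linear_family R C I (dual_trace t)"
  unfolding cyclic_linear_family_def
proof (intro conjI ballI)
  have ob: "V \<in> Ob C" if "V \<in> I" for V using that I by (auto simp: left_ideal_def)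
  {
    fix V assume "V \<in> I"
    moreover from this have "dual V \<otimes>\<^sub>o V \<in> I" using I ob dual_Ob by (auto simp: left_ideal_def)
    ultimately show "linear_form R (Hom C V V) (dual_trace t V)"
      using t ob by (intro linear_form_dual_trace) (auto simp: cyclic_linear_family_def)
  }
  fix U V f g assume *: "U \<in> I" "V \<in> I" "f \<in> mor V U" "g \<in> mor U V"
  then show "dual_trace t V (g \<cdot> f) = dual_trace t U (f \<cdot> g)"
    using dual_trace_commute[OF t I, of "Arrow V f U" "Arrow U g V" V U] ob
    by (simp add: value_at_def cmp_def)
qed

section \<open>Objects on which a trace agrees with its dual\<close>

definition agree_at where
  "agree_at t s V \<longleftrightarrow> (\<forall>f\<in>mor V V. t V f = s V f)"

lemma agree_atD:
  "\<lbrakk>agree_at t s V; arr x; src x = V; trg x = V\<rbrakk> \<Longrightarrow> value_at t x = value_at s x"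
  using arr_label[of x] by (auto simp: agree_at_def value_at_def)

lemma agree_at_retract:
  assumes ts: "cyclic_linear_family R C I t" "cyclic_linear_family R C I s"
    and VW: "V \<in> I" "W \<in> I" "retract_of C V W" and agree: "agree_at t s W"
  shows "agree_at t s V"
  unfolding agree_at_def
proof
  fix f assume f: "f \<in> mor V V"
  from VW(3) obtain \<alpha> \<beta> where V: "V \<in> Ob C" "W \<in> Ob C" "\<alpha> \<in> mor V W" "\<beta> \<in> mor W V"
    and inv: "\<beta> \<cdot> \<alpha> = Idm V"
    unfolding retract_of_def retract_via_def by blast
  have f_eq: "f = \<beta> \<cdot> (\<alpha> \<cdot> f)"
    using Comp_assoc[of V V W V f \<alpha> \<beta>] V f inv by (simp add: Idm_Comp[of V V])
  have \<alpha>f: "\<alpha> \<cdot> f \<in> mor V W" using V f Comp_closed[of V V W] by simp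
  have "r V f = r W ((\<alpha> \<cdot> f) \<cdot> \<beta>)" if "cyclic_linear_family R C I r" for r
    using that VW V(4) \<alpha>f unfolding cyclic_linear_family_def by (subst f_eq) blast
  moreover have "(\<alpha> \<cdot> f) \<cdot> \<beta> \<in> mor W W"
    using \<alpha>f V Comp_closed[of W V W] by simp
  ultimately show "t V f = s V f" using ts agree unfolding agree_at_def by metis
qed

lemma agree_at_direct_sum:
  assumes ts: "cyclic_linear_family R C I t" "cyclic_linear_family R C I s"
    and W: "W \<in> I" "set Vs \<subseteq> I" "direct_sum C W Vs" and agree: "\<And>V. V \<in> set Vs \<Longrightarrow> agree_at t s V"
  shows "agree_at t s W"
  unfolding agree_at_def
proof
  fix f assume f: "f \<in> mor W W"
  from W(3) obtain \<alpha> \<beta> where ob [simp]: "W \<in> Ob C" "set Vs \<subseteq> Ob C"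
    and retr: "\<And>i. i < length Vs \<Longrightarrow> retract_via C (Vs ! i) W (\<alpha> i) (\<beta> i)"
    and Id: "Idm W = (\<Oplus>\<^bsub>Hom C W W\<^esub>i\<in>{..<length Vs}. \<alpha> i \<cdot> \<beta> i)"
    unfolding direct_sum_def by blast
  interpret module R "Hom C W W" by (rule Hom_module) simp_all
  have lin: "linear_form R (Hom C W W) (\<lambda>x. r W (f \<cdot> x))" if "cyclic_linear_family R C I r" for r
  proof -
    have "linear_form R (Hom C W W) (r W)" using that W by (simp add: cyclic_linear_family_def)
    moreover have "f \<cdot> x \<in> mor W W" if "x \<in> mor W W" for x using that f Comp_closed[of W W W] by simp
    ultimately show ?thesis
      using f unfolding linear_form_def
      by (simp add: Pi_iff Comp_add_right[of W W W] Comp_smult_right[of W W W])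
  qed
  have summand: "Vs ! i \<in> Ob C" "Vs ! i \<in> I" "\<alpha> i \<in> mor (Vs ! i) W" "\<beta> i \<in> mor W (Vs ! i)"
    if "i < length Vs" for i
    using retr[OF that] that ob(2) W(2) nth_mem[OF that] unfolding retract_via_def by blast+
  \<comment> \<open>Both sides are linear in the right factor, so the decomposition of \<open>Idm W\<close> reduces the claim to
      \<open>f \<alpha>\<^sub>i \<beta>\<^sub>i\<close>, which cyclicity moves to the summand.\<close>
  have "t W (f \<cdot> Idm W) = s W (f \<cdot> Idm W)"
    unfolding Id
  proof (rule linear_forms_eq_finsum[OF module_axioms lin[OF ts(1)] lin[OF ts(2)]])
    show "(\<lambda>i. \<alpha> i \<cdot> \<beta> i) \<in> {..<length Vs} \<rightarrow> mor W W"
    proof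
      fix i assume "i \<in> {..<length Vs}"
      then show "\<alpha> i \<cdot> \<beta> i \<in> mor W W"
        using summand[of i] Comp_closed[of W "Vs ! i" W "\<beta> i" "\<alpha> i"] by simp
    qed
    fix i assume "i \<in> {..<length Vs}"
    then have i: "i < length Vs" by simp
    note s = summand[OF i]
    have f\<alpha>: "f \<cdot> \<alpha> i \<in> mor (Vs ! i) W" using Comp_closed[of "Vs ! i" W W] f s by simp
    have "r W (f \<cdot> (\<alpha> i \<cdot> \<beta> i)) = r (Vs ! i) (\<beta> i \<cdot> (f \<cdot> \<alpha> i))" if "cyclic_linear_family R C I r" for r
      using that W(1) s f f\<alpha> Comp_assoc[of W "Vs ! i" W W "\<beta> i" "\<alpha> i" f]
      unfolding cyclic_linear_family_def by auto
    moreover have "\<beta> i \<cdot> (f \<cdot> \<alpha> i) \<in> mor (Vs ! i) (Vs ! i)"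
      using f\<alpha> s Comp_closed[of "Vs ! i" W "Vs ! i"] by simp
    ultimately show "t W (f \<cdot> (\<alpha> i \<cdot> \<beta> i)) = s W (f \<cdot> (\<alpha> i \<cdot> \<beta> i))"
      using ts agree[OF nth_mem[OF i]] unfolding agree_at_def by metis
  qed simp
  then show "t W f = s W f" using f by (simp add: Comp_Idm[of W W])
qed

lemma agree_at_simple:
  assumes ts: "cyclic_linear_family R C I t" "cyclic_linear_family R C I s"
    and V: "V \<in> I" "simple_obj C R V" and dim: "mdim C t V = mdim C s V"
  shows "agree_at t s V"
  unfolding agree_at_def
proof
  fix f assume "f \<in> mor V V"
  then obtain a where a: "a \<in> carrier R" "f = a \<odot>\<^bsub>Hom C V V\<^esub> Idm V" and "V \<in> Ob C"
    using V(2) unfolding simple_obj_def by blast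
  then have "r V f = a \<otimes>\<^bsub>R\<^esub> mdim C r V" if "cyclic_linear_family R C I r" for r
    using that V(1) Idm_closed[of V]
    unfolding cyclic_linear_family_def linear_form_def mdim_def by blast
  then show "t V f = s V f" using ts dim by metis
qed

lemma retract_of_summand:
  assumes "direct_sum C W Vs" "V \<in> set Vs"
  shows "retract_of C V W"
proof -
  obtain i where "i < length Vs" "V = Vs ! i" using assms(2) by (auto simp: in_set_conv_nth)
  moreover from this obtain \<alpha> \<beta> where "retract_via C V W \<alpha> \<beta>"
    using assms(1) unfolding direct_sum_def by blast
  ultimately show ?thesis
    using assms unfolding direct_sum_def retract_of_def by blast
qed

text \<open>The mixing step: \<open>t\<close> has a right trace property and its dual a left one, and the two partial traces
  commute. So \<open>t\<close> on \<open>A \<otimes> S \<otimes> B\<close> reduces to \<open>A \<otimes> S\<close>, where the traces agree, then as a left trace to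
  \<open>S\<close>, where they agree again; the same route backwards through \<open>S \<otimes> B\<close> arrives at the dual
  trace.\<close>

lemma agree_at_sandwich:
  assumes t: "right_trace R C I t" and I: "left_ideal C I"
    and S: "S \<in> I" and [simp]: "A \<in> Ob C" "B \<in> Ob C"
    and agree: "agree_at t (dual_trace t) S" "agree_at t (dual_trace t) (A \<otimes>\<^sub>o S)"
      "agree_at t (dual_trace t) (S \<otimes>\<^sub>o B)"
  shows "agree_at t (dual_trace t) (A \<otimes>\<^sub>o (S \<otimes>\<^sub>o B))"
  unfolding agree_at_def
proof
  let ?T = "A \<otimes>\<^sub>o (S \<otimes>\<^sub>o B)"
  have cyc: "cyclic_linear_family R C I t" and rI: "right_ideal C I"
    using t by (simp_all add: right_trace_def)
  have [simp]: "S \<in> Ob C" using S I by (auto simp: left_ideal_def)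
  have AS: "A \<otimes>\<^sub>o S \<in> I" and SB: "S \<otimes>\<^sub>o B \<in> I"
    using S I rI by (auto simp: left_ideal_def right_ideal_def)
  fix f assume f: "f \<in> mor ?T ?T"
  define x where "x = Arrow ?T f ?T"
  have [simp]: "arr x" "src x = ?T" "trg x = ?T" using f by (simp_all add: x_def)
  have "value_at t x = value_at t (ptraceR (A \<otimes>\<^sub>o S) B x)"
    by (rule right_traceD[OF t AS]) simp_all
  also have "\<dots> = value_at (dual_trace t) (ptraceR (A \<otimes>\<^sub>o S) B x)"
    by (rule agree_atD[OF agree(2)]) simp_all
  also have "\<dots> = value_at (dual_trace t) (ptraceL A S (ptraceR (A \<otimes>\<^sub>o S) B x))"
    by (rule dual_trace_ptraceL[OF cyc I S]) simp_all
  also have "\<dots> = value_at t (ptraceL A S (ptraceR (A \<otimes>\<^sub>o S) B x))"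
    by (rule agree_atD[OF agree(1), symmetric]) simp_all
  also have "\<dots> = value_at t (ptraceR S B (ptraceL A (S \<otimes>\<^sub>o B) x))"
    by (simp add: ptraces_commute)
  also have "\<dots> = value_at t (ptraceL A (S \<otimes>\<^sub>o B) x)"
    by (rule right_traceD[OF t S, symmetric]) simp_all
  also have "\<dots> = value_at (dual_trace t) (ptraceL A (S \<otimes>\<^sub>o B) x)"
    by (rule agree_atD[OF agree(3)]) simp_all
  also have "\<dots> = value_at (dual_trace t) x"
    by (rule dual_trace_ptraceL[OF cyc I SB, symmetric]) simp_all
  finally show "t ?T f = dual_trace t ?T f" by (simp add: x_def value_at_def)
qed

lemma two_sided_traceI:
  assumes t: "right_trace R C I t" and I: "left_ideal C I"
    and agree: "\<And>V. V \<in> I \<Longrightarrow> agree_at t (dual_trace t) V"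
  shows "two_sided_trace R C I t"
proof -
  have cyc: "cyclic_linear_family R C I t" using t by (simp add: right_trace_def)
  have "t (W \<otimes>\<^sub>o U) f = t U (ptrL C W U f)"
    if UW: "U \<in> I" "W \<in> Ob C" and f: "f \<in> mor (W \<otimes>\<^sub>o U) (W \<otimes>\<^sub>o U)" for U W f
  proof -
    let ?x = "Arrow (W \<otimes>\<^sub>o U) f (W \<otimes>\<^sub>o U)"
    have [simp]: "U \<in> Ob C" "W \<in> Ob C" "W \<otimes>\<^sub>o U \<in> I"
      using UW I by (auto simp: left_ideal_def)
    have "value_at t ?x = value_at (dual_trace t) ?x"
      by (rule agree_atD[OF agree]) (use f in simp_all)
    also have "\<dots> = value_at (dual_trace t) (ptraceL W U ?x)"
      by (rule dual_trace_ptraceL[OF cyc I UW]) (use f in simp_all)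
    also have "\<dots> = value_at t (ptraceL W U ?x)"
      by (rule agree_atD[OF agree[OF UW(1)], symmetric]) (use f in simp_all)
    finally show ?thesis using f by (simp add: ptraceL_Arrow value_at_def)
  qed
  then show ?thesis using t I cyc by (simp add: two_sided_trace_def left_trace_def)
qed

end

section \<open>Generic degrees and the theorem\<close>

text \<open>Smallness in the form in which it is used: finitely many translates of one element can be kept
  out of \<open>X\<close> simultaneously. By symmetry of \<open>X\<close> this also holds for translates on the other side.\<close>

lemma small_subset_avoid_left:
  assumes "group G" "small_subset G X" "finite F" "F \<subseteq> carrier G"
  obtains g where "g \<in> carrier G" "\<And>a. a \<in> F \<Longrightarrow> a \<otimes>\<^bsub>G\<^esub> g \<notin> X"
proof -
  interpret group G by fact
  have X: "X \<subseteq> carrier G" using assms(2) by (simp add: small_subset_def)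
  let ?U = "\<Union>a\<in>m_inv G ` F. a <#\<^bsub>G\<^esub> X"
  have "finite (m_inv G ` F)" "m_inv G ` F \<subseteq> carrier G" using assms(3,4) by auto
  then have "?U \<noteq> carrier G" using assms(2) unfolding small_subset_def by blast
  moreover have "?U \<subseteq> carrier G" using X assms(4) by (auto simp: l_coset_def)
  ultimately obtain g where g: "g \<in> carrier G" "g \<notin> ?U" by blast
  show thesis
  proof (rule that[OF g(1)])
    fix a assume a: "a \<in> F"
    then have "g = inv\<^bsub>G\<^esub> a \<otimes>\<^bsub>G\<^esub> (a \<otimes>\<^bsub>G\<^esub> g)" using assms(4) g(1) by (metis inv_solve_left m_closed subsetD)
    then show "a \<otimes>\<^bsub>G\<^esub> g \<notin> X" using g(2) a by (auto simp: l_coset_def)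
  qed
qed

lemma small_subset_avoid_right:
  assumes "group G" "small_subset G X" "symmetric_subset G X" "finite F" "F \<subseteq> carrier G"
  obtains g where "g \<in> carrier G" "\<And>a. a \<in> F \<Longrightarrow> g \<otimes>\<^bsub>G\<^esub> a \<notin> X"
proof -
  interpret group G by fact
  obtain g where g: "g \<in> carrier G" "\<And>a. a \<in> m_inv G ` F \<Longrightarrow> a \<otimes>\<^bsub>G\<^esub> g \<notin> X"
    using small_subset_avoid_left[OF assms(1,2), of "m_inv G ` F"] assms(4,5) by auto
  show thesis
  proof
    show "inv\<^bsub>G\<^esub> g \<in> carrier G" using g by simp
    fix a assume a: "a \<in> F"
    then have [simp]: "a \<in> carrier G" using assms(5) by auto
    have "inv\<^bsub>G\<^esub> (inv\<^bsub>G\<^esub> g \<otimes>\<^bsub>G\<^esub> a) \<notin> X" using g a by (simp add: inv_mult_group)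
    moreover have "set_inv\<^bsub>G\<^esub> X = X" using assms(3) by (simp add: symmetric_subset_def)
    ultimately show "inv\<^bsub>G\<^esub> g \<otimes>\<^bsub>G\<^esub> a \<notin> X" unfolding SET_INV_def by blast
  qed
qed

theorem theorem14:
  fixes R :: "('k, 'r) ring_scheme"
    and G :: "('g, 'h) monoid_scheme"
    and C :: "('k, 'o, 'm, 'z) pivotal_data_scheme"
    and Cg :: "'g \<Rightarrow> 'o set"
    and X :: "'g set"
    and t :: "'o \<Rightarrow> 'm \<Rightarrow> 'k"
  assumes "domain R"
    and "group G"
    and "pivotal_k_category R C"
    and "generically_semisimple R G C Cg X"
    and "krull_schmidt C"
    and "\<And>V. nonzero C V \<Longrightarrow> faithful_tensor C V"
    and "right_trace R C (Proj C) t"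
    and "\<And>V. generic_simple R G C Cg X V \<Longrightarrow> V \<in> Proj C \<Longrightarrow> mdim C t V = mdim C t (dual\<^bsub>C\<^esub> V)"
  shows "two_sided_trace R C (Proj C) t"
proof -
  interpret group G by fact
  interpret pivotal_k_category R C by fact
  let ?s = "dual_trace t"
  have gr: "graded G C Cg" and X: "symmetric_subset G X" "small_subset G X"
    and ss: "\<And>g V. \<lbrakk>g \<in> carrier G - X; V \<in> Cg g\<rbrakk> \<Longrightarrow> semisimple_obj C R V"
    using assms(4) unfolding generically_semisimple_def by blast+
  note graded = gr[unfolded graded_def]
  note Cg_basic = graded[THEN conjunct1]
    and Cg_sum = graded[THEN conjunct2, THEN conjunct1]
    and Cg_dual_tens = graded[THEN conjunct2, THEN conjunct2, THEN conjunct1]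
      graded[THEN conjunct2, THEN conjunct2, THEN conjunct2, THEN conjunct1]
  have Cg_nonzero: "\<exists>V\<in>Cg g. nonzero C V" if "g \<in> carrier G" for g
    using that Cg_basic by blast
  have Cg_retract: "V \<in> Cg g" if "g \<in> carrier G" "W \<in> Cg g" "retract_of C V W" for g V W
    using that Cg_basic by blast
  have Cg_dual: "dual\<^bsub>C\<^esub> V \<in> Cg (inv\<^bsub>G\<^esub> g)" if "g \<in> carrier G" "V \<in> Cg g" for g V
    using that Cg_dual_tens(1) by blast
  have Cg_tens: "V \<otimes>\<^sub>o\<^bsub>C\<^esub> V' \<in> Cg (g \<otimes>\<^bsub>G\<^esub> g')"
    if "g \<in> carrier G" "g' \<in> carrier G" "V \<in> Cg g" "V' \<in> Cg g'" for g g' V V'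
    using that Cg_dual_tens(2) by blast
  have cyc: "cyclic_linear_family R C (Proj C) t" and rI: "right_ideal C (Proj C)"
    using assms(7) by (simp_all add: right_trace_def)
  have lI: "left_ideal C (Proj C)" using rI by (rule left_ideal_Proj)
  have cyc': "cyclic_linear_family R C (Proj C) ?s"
    using cyc lI by (rule cyclic_linear_dual_trace)
  have Proj_ob: "P \<in> Ob C" if "P \<in> Proj C" for P using that by (simp add: Proj_def)
  have Proj_retract: "V \<in> Proj C" if "W \<in> Proj C" "retract_of C V W" for V W
    using that rI unfolding right_ideal_def by blast
  have Proj_tens: "P \<otimes>\<^sub>o\<^bsub>C\<^esub> W \<in> Proj C" if "P \<in> Proj C" "W \<in> Ob C" for P W
    using that rI unfolding right_ideal_def by blast
  have generic: "agree_at t ?s S" if S: "S \<in> Proj C" "S \<in> Cg g" and g: "g \<in> carrier G" "g \<notin> X" for S g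
  proof -
    obtain Vs where Vs: "direct_sum C S Vs" "\<And>V. V \<in> set Vs \<Longrightarrow> simple_obj C R V"
      using ss[of g S] S g unfolding semisimple_obj_def by blast
    have V_Proj: "V \<in> Proj C" if "V \<in> set Vs" for V
      using Proj_retract[OF S(1) retract_of_summand[OF Vs(1) that]] .
    show ?thesis
    proof (rule agree_at_direct_sum[OF cyc cyc' S(1) _ Vs(1)])
      fix V assume V: "V \<in> set Vs"
      have "V \<in> Cg g" using Cg_retract[OF g(1) S(2) retract_of_summand[OF Vs(1) V]] .
      then have "generic_simple R G C Cg X V" using Vs(2)[OF V] g unfolding generic_simple_def by blast
      then have "mdim C t V = mdim C t (dual\<^bsub>C\<^esub> V)" using V_Proj[OF V] by (rule assms(8))
      also have "\<dots> = mdim C ?s V"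
        using mdim_dual_trace[OF assms(7) Proj_ob dual_Proj[OF rI]] V_Proj[OF V] by simp
      finally show "agree_at t ?s V"
        using agree_at_simple[OF cyc cyc' V_Proj[OF V] Vs(2)[OF V]] by simp
    qed (use V_Proj in blast)
  qed
  have homogeneous: "agree_at t ?s P" if P: "P \<in> Proj C" "P \<in> Cg h" and h: "h \<in> carrier G" for P h
  proof -
    \<comment> \<open>\<open>P\<close> is exhibited as a retract of \<open>A \<otimes> S \<otimes> B\<close> with \<open>A = Q\<^sup>*\<close>, \<open>S = Q \<otimes> P \<otimes> Q'\<close>, \<open>B = Q'\<^sup>*\<close>. For \<open>Q\<close>
      and \<open>Q'\<close> of degrees \<open>a\<close> and \<open>b\<close>, the objects \<open>A \<otimes> S\<close>, \<open>S \<otimes> B\<close> and \<open>S\<close> have degrees \<open>h b\<close>, \<open>a h\<close>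
      and \<open>a h b\<close>, which are kept out of \<open>X\<close> by choosing \<open>b\<close> before \<open>a\<close>.\<close>
    obtain b where b: "b \<in> carrier G" and b_avoid: "\<And>c. c \<in> {h} \<Longrightarrow> c \<otimes>\<^bsub>G\<^esub> b \<notin> X"
      using small_subset_avoid_left[OF assms(2) X(2), of "{h}"] h by blast
    have hb [simp]: "h \<otimes>\<^bsub>G\<^esub> b \<in> carrier G" using h b by simp
    obtain a where a: "a \<in> carrier G" and a_avoid: "\<And>c. c \<in> {h, h \<otimes>\<^bsub>G\<^esub> b} \<Longrightarrow> a \<otimes>\<^bsub>G\<^esub> c \<notin> X"
      using small_subset_avoid_right[OF assms(2) X(2,1), of "{h, h \<otimes>\<^bsub>G\<^esub> b}"] h hb by blast
    note [simp] = h a b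
    obtain Q where Q: "Q \<in> Cg a" "nonzero C Q" using Cg_nonzero[OF a] by blast
    obtain Q' where Q': "Q' \<in> Cg b" "nonzero C Q'" using Cg_nonzero[OF b] by blast
    have [simp]: "Q \<in> Ob C" "Q' \<in> Ob C" "P \<in> Ob C" using Q(2) Q'(2) Proj_ob[OF P(1)] by (simp_all add: nonzero_def)
    let ?A = "dual\<^bsub>C\<^esub> Q" and ?S = "Q \<otimes>\<^sub>o\<^bsub>C\<^esub> (P \<otimes>\<^sub>o\<^bsub>C\<^esub> Q')" and ?B = "dual\<^bsub>C\<^esub> Q'"
    have S: "?S \<in> Proj C" by (intro tens_Proj Proj_tens P) simp_all
    have S_deg: "?S \<in> Cg (a \<otimes>\<^bsub>G\<^esub> (h \<otimes>\<^bsub>G\<^esub> b))"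
      by (intro Cg_tens Q Q' P) simp_all
    have "?A \<otimes>\<^sub>o\<^bsub>C\<^esub> ?S \<in> Cg (inv\<^bsub>G\<^esub> a \<otimes>\<^bsub>G\<^esub> (a \<otimes>\<^bsub>G\<^esub> (h \<otimes>\<^bsub>G\<^esub> b)))"
      by (intro Cg_tens S_deg Cg_dual Q) simp_all
    then have AS_deg: "?A \<otimes>\<^sub>o\<^bsub>C\<^esub> ?S \<in> Cg (h \<otimes>\<^bsub>G\<^esub> b)"
      by (simp flip: m_assoc)
    have "?S \<otimes>\<^sub>o\<^bsub>C\<^esub> ?B \<in> Cg ((a \<otimes>\<^bsub>G\<^esub> (h \<otimes>\<^bsub>G\<^esub> b)) \<otimes>\<^bsub>G\<^esub> inv\<^bsub>G\<^esub> b)"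
      by (intro Cg_tens S_deg Cg_dual Q') simp_all
    then have SB_deg: "?S \<otimes>\<^sub>o\<^bsub>C\<^esub> ?B \<in> Cg (a \<otimes>\<^bsub>G\<^esub> h)"
      by (simp add: m_assoc)
    have "agree_at t ?s (?A \<otimes>\<^sub>o\<^bsub>C\<^esub> (?S \<otimes>\<^sub>o\<^bsub>C\<^esub> ?B))"
    proof (rule agree_at_sandwich[OF assms(7) lI S])
      show "agree_at t ?s ?S" using generic[OF S S_deg _ a_avoid] by simp
      show "agree_at t ?s (?A \<otimes>\<^sub>o\<^bsub>C\<^esub> ?S)"
        using generic[OF tens_Proj[OF S] AS_deg _ b_avoid] by simp
      show "agree_at t ?s (?S \<otimes>\<^sub>o\<^bsub>C\<^esub> ?B)"
        using generic[OF Proj_tens[OF S] SB_deg _ a_avoid] by simp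
    qed simp_all
    moreover let ?P = "P \<otimes>\<^sub>o\<^bsub>C\<^esub> (Q' \<otimes>\<^sub>o\<^bsub>C\<^esub> dual\<^bsub>C\<^esub> Q')"
    have P': "?P \<in> Proj C" by (rule Proj_tens[OF P(1)]) simp
    ultimately have "agree_at t ?s (dual\<^bsub>C\<^esub> Q \<otimes>\<^sub>o\<^bsub>C\<^esub> (Q \<otimes>\<^sub>o\<^bsub>C\<^esub> ?P))" by simp
    then have "agree_at t ?s ?P"
      by (rule agree_at_retract[OF cyc cyc' P' _ Proj_retract_left[OF P' _ assms(6)[OF Q(2)]], rotated 2])
        (simp_all add: tens_Proj P')
    then show ?thesis
      by (rule agree_at_retract[OF cyc cyc' P(1) P' Proj_retract_right[OF P(1) _ assms(6)[OF Q'(2)]], rotated])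
        simp
  qed
  have "agree_at t ?s P" if P: "P \<in> Proj C" for P
  proof -
    obtain Vs where Vs: "direct_sum C P Vs" "\<And>V. V \<in> set Vs \<Longrightarrow> \<exists>g\<in>carrier G. V \<in> Cg g"
      using bspec[OF Cg_sum Proj_ob[OF P]] by blast
    have V_Proj: "V \<in> Proj C" if "V \<in> set Vs" for V
      using Proj_retract[OF P retract_of_summand[OF Vs(1) that]] .
    show ?thesis
      by (rule agree_at_direct_sum[OF cyc cyc' P _ Vs(1)]) (use V_Proj Vs(2) homogeneous in blast)+
  qed
  then show ?thesis by (rule two_sided_traceI[OF assms(7) lI])
qed

end
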